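(* Let $p \in [0,1]$ and let $X$ be a real-valued random variable. Let $T$ be the following random tree: - the genealogical structure of $T$ is a Galton–Watson tree with geometric offspring distribution with parameter $p$; - the labels on the edges are i.i.d. with the distribution of $X$, independent of the genealogical structure, and the root has label $0$; - all nodes are white, except for the root, which is green. Let $(B_n, n \ge 0)$ be the one-sided limit order book Markov chain with parameters $p$ and $X$ started at $B_0 = \delta_0$, and let $\tau = \inf\{n \ge 0 : |B_n| = 0\}$. Then, with $\Gamma$, $\Phi_n$, $\kappa$ as defined in the context, the process $(\Gamma(\Phi_n(T)), 0 \le n \le \kappa(T))$ is equal in distribution to $(B_n, 0 \le n \le \tau)$.
   Context: Order book. A book is a finite point measure on $\mathbb{R}$, i.e. a finite (possibly empty) sum of Dirac masses $\delta_x$ (with multiplicity); $\mathcal{B}$ is the set of books, $|\beta|$ is the total mass of $\beta \in \mathcal{B}$, and the price is $\pi(\beta) = \max\{x \in \mathbb{R}: \beta(\{x\})>0\}$ if $|\beta|>0$, $\pi(\beta) = 0$ if $|\beta|=0$. The one-sided limit order book Markov chain with parameters $p$, $X$ is the $\mathcal{B}$-valued Markov chain such that for every $\beta \in \mathcal{B}$ and every measurable $f: \mathcal{B} \to [0,\infty)$, $$\mathbb{E}[f(B_{n+1}) \mid B_n = \beta] = f(\delta_0)\mathbf{1}_{\{|\beta|=0\}} + p\,\mathbb{E}[f(\beta+\delta_{\pi(\beta)+X})]\mathbf{1}_{\{|\beta|>0\}} + (1-p) f(\beta-\delta_{\pi(\beta)})\mathbf{1}_{\{|\beta|>0\}}.$$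 Trees. Trees are rooted and ordered (the children of each node are ordered as first, second, etc.); nodes are realized as finite words of positive integers (Ulam–Harris coding), and are ordered by the lexicographical order (a node precedes its descendants). Let $\mathcal{T}$ be the set of rooted trees such that: every edge has a real-valued label; every node has one of three colors, green, red or white; finitely many nodes are green or red, and the set of nodes that are green or red is connected; the root is green or red. The root has a real-valued label, and the label $\ell(v,t)$ of a non-root node $v$ in $t$ is the label of its parent plus the label of the edge between them. For $t \in \mathcal{T}$, $\mathcal{G}(t)$ is the set of green nodes of $t$, and $\Gamma(t) = \sum_{v \in \mathcal{G}(t)} \delta_{\ell(v,t)} \in \mathcal{B}$. If $|\mathcal{G}(t)| > 0$, $\gamma(t)$ is the green node with largest label (if there are several, the last one in lexicographical order), and $\omega(t)$ is the number of white children of $\gamma(t)$. Operator $\Phi: \mathcal{T} \to \mathcal{T}$. If $|\mathcal{G}(t)| = 0$, then $\Phi(t) = t$. If $|\mathcal{G}(t)|>0$, then $\Phi$ changes the color of one node: if $\omega(t) > 0$, the first white child of $\gamma(t)$ is turned green; if $\omega(t) = 0$, $\gamma(t)$ is turned red. $\Phi_0$ is the identity, $\Phi_{n+1} = \Phi \circ \Phi_n$ for $n \ge 0$, and $\kappa(t) = \inf\{n \ge 0 : |\mathcal{G}(\Phi_n(t))| = 0\} \in \{0,1,\ldots,\infty\}$. The geometric offspring distribution with parameter $p$ is the law of a number $N$ of children with $\mathbb{P}(N \ge k) = p^k$ for $k = 0,1,2,\ldots$ (so $\mathbb{P}(N=k) = (1-p)p^k$ if $p<1$, and $N=\infty$ if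 $p=1$). When $\kappa(T)=\infty$ or $\tau = \infty$, the corresponding process is indexed by all $n \ge 0$. Infima of empty sets are $\infty$. *)

theory Defs
  imports "HOL-Probability.Probability"
begin

section \<open>Books\<close>

text \<open>
  A finite sum of Dirac masses on the real line is a finite multiset of reals; the Dirac mass at
  \<open>x\<close> is \<open>{#x#}\<close>, the total mass is \<open>size\<close>. The space of books carries the usual
  sigma-algebra on point measures, generated by the evaluations at Borel sets.
\<close>

type_synonym book = "real multiset"

definition mass :: "book \<Rightarrow> real set \<Rightarrow> nat" where
  "mass \<beta> A = size (filter_mset (\<lambda>x. x \<in> A) \<beta>)"

definition book_space :: "book measure" where
  "book_space = sigma UNIV {{\<beta>. mass \<beta> A = k} | A k. A \<in> sets borel}"

definition price :: "book \<Rightarrow> real" where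
  "price \<beta> = (if \<beta> = {#} then 0 else Max (set_mset \<beta>))"


section \<open>The one-sided limit order book Markov chain\<close>

definition lob_step :: "real \<Rightarrow> 'b measure \<Rightarrow> ('b \<Rightarrow> real) \<Rightarrow> (book \<Rightarrow> ennreal) \<Rightarrow> book \<Rightarrow> ennreal" where
  "lob_step p N X f \<beta> =
     (if size \<beta> = 0 then f {#0#}
      else ennreal p * (\<integral>\<^sup>+ \<omega>. f (\<beta> + {#price \<beta> + X \<omega>#}) \<partial>N)
           + ennreal (1 - p) * f (\<beta> - {#price \<beta>#}))"

definition history :: "'c measure \<Rightarrow> (nat \<Rightarrow> 'c \<Rightarrow> book) \<Rightarrow> nat \<Rightarrow> 'c measure" where
  "history M B n =
     sigma (space M) {B k -` A \<inter> space M | k A. k \<le> n \<and> A \<in> sets book_space}"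

definition lob_chain ::
    "real \<Rightarrow> 'b measure \<Rightarrow> ('b \<Rightarrow> real) \<Rightarrow> 'c measure \<Rightarrow> (nat \<Rightarrow> 'c \<Rightarrow> book) \<Rightarrow> bool" where
  "lob_chain p N X M B \<longleftrightarrow>
     prob_space M \<and>
     (\<forall>n. B n \<in> M \<rightarrow>\<^sub>M book_space) \<and>
     (\<forall>n. \<forall>f \<in> borel_measurable book_space. (\<forall>\<beta>. f \<beta> < \<infinity>) \<longrightarrow>
        (AE \<omega> in M. nn_cond_exp M (history M B n) (\<lambda>\<omega>. f (B (Suc n) \<omega>)) \<omega>
                      = lob_step p N X f (B n \<omega>)))"

definition tau :: "(nat \<Rightarrow> book) \<Rightarrow> enat" where
  "tau b = Inf {enat n | n. size (b n) = 0}"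


section \<open>Labelled coloured trees\<close>

datatype color = Green | Red | White

text \<open>
  Nodes are words of positive integers; the children of \<open>v\<close> are the nodes \<open>v @ [i]\<close>. For a
  non-root node \<open>v\<close>, \<open>edge_label t v\<close> is the label of the edge between \<open>v\<close> and its parent.
  The values of \<open>edge_label t\<close> at \<open>[]\<close> and outside \<open>nodes t\<close>, and those of \<open>color t\<close>
  outside \<open>nodes t\<close>, carry no meaning.
\<close>

record ltree =
  nodes :: "nat list set"
  root_label :: real
  edge_label :: "nat list \<Rightarrow> real"
  color :: "nat list \<Rightarrow> color"

definition ulam_harris :: "nat list set \<Rightarrow> bool" where
  "ulam_harris V \<longleftrightarrow>
     [] \<in> V \<and>
     (\<forall>v i. v @ [i] \<in> V \<longrightarrow> v \<in> V \<and> 1 \<le> i \<and> (\<forall>j. 1 \<le> j \<and> j \<le> i \<longrightarrow> v @ [j] \<in> V))"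

definition adjacent :: "(nat list \<times> nat list) set" where
  "adjacent = {(u, v). \<exists>i. v = u @ [i] \<or> u = v @ [i]}"

definition connected_nodes :: "nat list set \<Rightarrow> bool" where
  "connected_nodes S \<longleftrightarrow> (\<forall>u\<in>S. \<forall>v\<in>S. (u, v) \<in> (adjacent \<inter> S \<times> S)\<^sup>*)"

definition trees :: "ltree set" where
  "trees = {t. ulam_harris (nodes t) \<and>
               finite {v \<in> nodes t. color t v \<in> {Green, Red}} \<and>
               connected_nodes {v \<in> nodes t. color t v \<in> {Green, Red}} \<and>
               color t [] \<in> {Green, Red}}"

text \<open>The sigma-algebra generated by the meaningful coordinates of a tree.\<close>

definition tree_space :: "ltree measure" where
  "tree_space = sigma trees
     ({{t \<in> trees. v \<in> nodes t} | v. True}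
      \<union> {{t \<in> trees. root_label t \<in> A} | A. A \<in> sets borel}
      \<union> {{t \<in> trees. v \<in> nodes t \<and> edge_label t v \<in> A} | v A. v \<noteq> [] \<and> A \<in> sets borel}
      \<union> {{t \<in> trees. v \<in> nodes t \<and> color t v = c} | v c. True})"

function label :: "nat list \<Rightarrow> ltree \<Rightarrow> real" where
  "label v t = (if v = [] then root_label t else label (butlast v) t + edge_label t v)"
  by pat_completeness auto
termination by (relation "Wellfounded.measure (\<lambda>(v, t). length v)") auto

declare label.simps [simp del]

definition green :: "ltree \<Rightarrow> nat list set" where
  "green t = {v \<in> nodes t. color t v = Green}"

definition Gamma_book :: "ltree \<Rightarrow> book" where
  "Gamma_book t = image_mset (\<lambda>v. label v t) (mset_set (green t))"

text \<open>
  \<open>lexord less_than\<close> is the strict lexicographical order on words, in which every proper prefix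
  of a word precedes it; hence the following node is unique whenever \<open>green t\<close> is finite and
  nonempty.
\<close>

definition gamma_node :: "ltree \<Rightarrow> nat list" where
  "gamma_node t =
     (THE v. v \<in> green t \<and>
        (\<forall>u \<in> green t. label u t < label v t \<or>
           (label u t = label v t \<and> (u = v \<or> (u, v) \<in> lexord less_than))))"

definition white_children :: "ltree \<Rightarrow> nat list \<Rightarrow> nat set" where
  "white_children t v = {i. v @ [i] \<in> nodes t \<and> color t (v @ [i]) = White}"

definition omega :: "ltree \<Rightarrow> enat" where
  "omega t = (let W = white_children t (gamma_node t) in if finite W then enat (card W) else \<infinity>)"

definition Phi :: "ltree \<Rightarrow> ltree" where
  "Phi t =
     (if green t = {} then t
      else if omega t > 0
      then t\<lparr>color := (color t)
              (gamma_node t @ [LEAST i. i \<in> white_children t (gamma_node t)] := Green)\<rparr>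
      else t\<lparr>color := (color t)(gamma_node t := Red)\<rparr>)"

definition kappa :: "ltree \<Rightarrow> enat" where
  "kappa t = Inf {enat n | n. green ((Phi ^^ n) t) = {}}"


section \<open>The random tree\<close>

definition offspring_pmf :: "real \<Rightarrow> enat pmf" where
  "offspring_pmf p = (if p = 1 then return_pmf \<infinity> else map_pmf enat (geometric_pmf (1 - p)))"

lemma offspring_pmf_tail:
  assumes "0 \<le> p" "p \<le> 1"
  shows "measure (offspring_pmf p) {n. enat k \<le> n} = p ^ k"
proof (cases "p = 1")
  case True
  then show ?thesis by (simp add: offspring_pmf_def)
next
  case False
  with assms have p: "0 \<le> p" "p < 1" by auto
  have "measure (geometric_pmf (1 - p)) {..<k} = (\<Sum>i<k. p ^ i * (1 - p))"
    using p by (simp add: measure_measure_pmf_finite)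
  also have "\<dots> = 1 - p ^ k"
    using p by (induction k) (auto simp: algebra_simps)
  finally have "measure (geometric_pmf (1 - p)) (UNIV - {..<k}) = p ^ k"
    by (subst measure_pmf.prob_compl[of "{..<k}" "geometric_pmf (1 - p)", simplified]) auto
  moreover have "enat -` {n. enat k \<le> n} = UNIV - {..<k}" by auto
  ultimately show ?thesis using False by (simp add: offspring_pmf_def)
qed

definition gw_nodes :: "(nat list \<Rightarrow> enat) \<Rightarrow> nat list set" where
  "gw_nodes K = {v. \<forall>k < length v. 1 \<le> v ! k \<and> enat (v ! k) \<le> K (take k v)}"

definition initial_tree :: "(nat list \<Rightarrow> enat) \<Rightarrow> (nat list \<Rightarrow> real) \<Rightarrow> ltree" where
  "initial_tree K L =
     \<lparr>nodes = gw_nodes K, root_label = 0, edge_label = L,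
      color = (\<lambda>v. if v = [] then Green else White)\<rparr>"

text \<open>
  The law of the tree built from a family of i.i.d. offspring numbers \<open>K v\<close> and an independent
  family of i.i.d. edge labels \<open>L v\<close> with law \<open>\<mu>\<close>, both indexed by all words.
\<close>

definition random_tree_law :: "real \<Rightarrow> real measure \<Rightarrow> ltree measure" where
  "random_tree_law p \<mu> =
     distr (PiM UNIV (\<lambda>_. measure_pmf (offspring_pmf p)) \<Otimes>\<^sub>M PiM UNIV (\<lambda>_. \<mu>)) tree_space
       (\<lambda>(K, L). initial_tree K L)"

lemma initial_tree_in_trees: "initial_tree K L \<in> trees"
proof -
  have "v \<in> gw_nodes K \<and> 1 \<le> i \<and> (\<forall>j. 1 \<le> j \<and> j \<le> i \<longrightarrow> v @ [j] \<in> gw_nodes K)"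
    if "v @ [i] \<in> gw_nodes K" for v i
  proof -
    have *: "1 \<le> (v @ [i]) ! k \<and> enat ((v @ [i]) ! k) \<le> K (take k (v @ [i]))"
      if "k \<le> length v" for k
      using \<open>v @ [i] \<in> gw_nodes K\<close> that by (auto simp: gw_nodes_def)
    have v: "v \<in> gw_nodes K"
      unfolding gw_nodes_def
    proof safe
      fix k assume "k < length v"
      with *[of k] show "1 \<le> v ! k" "enat (v ! k) \<le> K (take k v)"
        by (auto simp: nth_append)
    qed
    have i: "1 \<le> i" "enat i \<le> K v"
      using *[of "length v"] by (auto simp: nth_append)
    have "v @ [j] \<in> gw_nodes K" if j: "1 \<le> j" "j \<le> i" for j
    proof -
      have "enat j \<le> K v" using i(2) j(2) by (meson enat_ord_simps(1) order_trans)
      with v j show ?thesis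
        by (auto simp: gw_nodes_def nth_append less_Suc_eq)
    qed
    with v i show ?thesis by auto
  qed
  moreover have "[] \<in> gw_nodes K" by (simp add: gw_nodes_def)
  moreover have "nodes (initial_tree K L) = gw_nodes K" by (simp add: initial_tree_def)
  ultimately have "ulam_harris (nodes (initial_tree K L))"
    unfolding ulam_harris_def by metis
  moreover have "{v \<in> nodes (initial_tree K L). color (initial_tree K L) v \<in> {Green, Red}} = {[]}"
    by (auto simp: initial_tree_def gw_nodes_def)
  ultimately show ?thesis
    by (simp add: trees_def connected_nodes_def) (simp add: initial_tree_def)
qed

lemma measurable_initial_tree:
  assumes "sets \<mu> = sets borel"
  shows "(\<lambda>(K, L). initial_tree K L) \<in>
    (PiM UNIV (\<lambda>_. measure_pmf (offspring_pmf p)) \<Otimes>\<^sub>M PiM UNIV (\<lambda>_. \<mu>)) \<rightarrow>\<^sub>M tree_space"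
    (is "_ \<in> ?P \<rightarrow>\<^sub>M _")
proof -
  have K: "(\<lambda>x. fst x v) \<in> ?P \<rightarrow>\<^sub>M count_space UNIV" for v
  proof -
    have "(\<lambda>x. fst x v) \<in> ?P \<rightarrow>\<^sub>M measure_pmf (offspring_pmf p)" by measurable
    then show ?thesis by (simp cong: measurable_cong_sets)
  qed
  have L: "(\<lambda>x. snd x v) \<in> ?P \<rightarrow>\<^sub>M borel" for v
  proof -
    have "(\<lambda>x. snd x v) \<in> ?P \<rightarrow>\<^sub>M \<mu>" by measurable
    then show ?thesis using measurable_cong_sets[OF refl assms] by blast
  qed
  have node: "Measurable.pred ?P (\<lambda>x. v \<in> gw_nodes (fst x))" for v
    unfolding gw_nodes_def mem_Collect_eq using K by measurable
  have lab: "Measurable.pred ?P (\<lambda>x. snd x v \<in> A)" if "A \<in> sets borel" for v A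
    using L that by measurable
  show ?thesis
    unfolding tree_space_def
    apply (rule measurable_measure_of)
    subgoal by blast
    subgoal by (intro Pi_I) (simp only: case_prod_beta initial_tree_in_trees)
    subgoal for A
    proof -
      have gen: "(\<lambda>(K, L). initial_tree K L) -` {t \<in> trees. Q t} \<inter> space ?P \<in> sets ?P"
        if "Measurable.pred ?P (\<lambda>x. Q (initial_tree (fst x) (snd x)))" for Q
      proof -
        have "(\<lambda>(K, L). initial_tree K L) -` {t \<in> trees. Q t} \<inter> space ?P
            = {x \<in> space ?P. Q (initial_tree (fst x) (snd x))}"
          by (auto simp: initial_tree_in_trees)
        with that show ?thesis by (simp add: pred_def)
      qed
      assume "A \<in> {{t \<in> trees. v \<in> nodes t} | v. True}
      \<union> {{t \<in> trees. root_label t \<in> A} | A. A \<in> sets borel}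
      \<union> {{t \<in> trees. v \<in> nodes t \<and> edge_label t v \<in> A} | v A. v \<noteq> [] \<and> A \<in> sets borel}
      \<union> {{t \<in> trees. v \<in> nodes t \<and> color t v = c} | v c. True}"
      then consider
          (a) v where "A = {t \<in> trees. v \<in> nodes t}"
        | (b) C where "A = {t \<in> trees. root_label t \<in> C}"
        | (c) v C where "A = {t \<in> trees. v \<in> nodes t \<and> edge_label t v \<in> C}" "C \<in> sets borel"
        | (d) v c where "A = {t \<in> trees. v \<in> nodes t \<and> color t v = c}"
        by (elim UnE CollectE exE conjE) metis+
      then show ?thesis
      proof cases
        case a
        show ?thesis unfolding a by (rule gen[of "\<lambda>t. v \<in> nodes t"]) (simp add: initial_tree_def node)
      next
        case b
        show ?thesis unfolding b by (rule gen[of "\<lambda>t. root_label t \<in> C"]) (simp add: initial_tree_def)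
      next
        case c
        show ?thesis unfolding c(1)
          by (rule gen[of "\<lambda>t. v \<in> nodes t \<and> edge_label t v \<in> C"])
            (simp add: initial_tree_def pred_intros_logic node lab[OF c(2)])
      next
        case d
        show ?thesis unfolding d
          by (rule gen[of "\<lambda>t. v \<in> nodes t \<and> color t v = c"])
            (simp add: initial_tree_def pred_intros_logic node)
      qed
    qed
    done
qed


section \<open>Processes with a random finite or infinite lifetime\<close>

text \<open>
  A family \<open>(y n, 0 \<le> n \<le> \<sigma>)\<close> is encoded as a path that takes the value \<open>None\<close> at
  the times at which it is not defined.
\<close>

definition up_to :: "enat \<Rightarrow> (nat \<Rightarrow> 'a) \<Rightarrow> nat \<Rightarrow> 'a option" where
  "up_to \<sigma> y n = (if enat n \<le> \<sigma> then Some (y n) else None)"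

definition option_space :: "'a measure \<Rightarrow> 'a option measure" where
  "option_space S =
     sigma (insert None (Some ` space S)) (insert {None} {Some ` A | A. A \<in> sets S})"

definition path_space :: "(nat \<Rightarrow> book option) measure" where
  "path_space = PiM UNIV (\<lambda>_. option_space book_space)"

text \<open>
  Measurability is part of the notion, because \<open>distr\<close> is not meaningful for functions that
  are not measurable.
\<close>

definition eq_in_distr :: "'s measure \<Rightarrow> 'a measure \<Rightarrow> ('a \<Rightarrow> 's) \<Rightarrow> 'c measure \<Rightarrow> ('c \<Rightarrow> 's) \<Rightarrow> bool" where
  "eq_in_distr S M Y M' Z \<longleftrightarrow>
     Y \<in> M \<rightarrow>\<^sub>M S \<and> Z \<in> M' \<rightarrow>\<^sub>M S \<and> distr M S Y = distr M' S Z"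

end

theory Submission
  imports Defs
begin

text \<open>
  The operator \<open>Phi\<close> explores the tree, and at each time the coloured nodes with their labels are
  all that has been seen of it. Nothing is known about the children of a green node beyond those
  already coloured, and a red node is known to have no others. Since geometric variables are
  memoryless, the numbers of further children of the green nodes are again independent and
  geometric, also given the past, and the labels of the edges not yet seen are fresh. Hence the
  distinguished green node, whose label is the price of the book, has no further child with
  probability \<open>1 - p\<close>, and then its Dirac mass is removed; with probability \<open>p\<close> it has one,
  and then a Dirac mass is added at the price plus a fresh copy of \<open>X\<close>. This is the transition of
  the order book.

  The argument needs no conditioning on the tree side. A finite tree \<open>s\<close> of green and red
  nodes is completed by offspring numbers \<open>K\<close> and labels \<open>L\<close> to a full tree \<open>completion s K L\<close>,
  where \<open>K v\<close> counts only the further children if \<open>v\<close> is green in \<open>s\<close>. One step of \<open>Phi\<close> on a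
  completion of \<open>s\<close> gives a completion of \<open>close_node s v\<close> if \<open>K v = 0\<close>, and of
  \<open>add_child s v x\<close>, with \<open>K v\<close> lowered by one, otherwise (\<open>Phi_completion_close\<close>,
  \<open>Phi_completion_add\<close>). The split of one offspring number into these two cases
  (\<open>nn_integral_PiM_offspring\<close>) and induction on the time horizon, for all \<open>s\<close> at once, give the
  finite-dimensional laws of the path of books (\<open>nn_integral_tree_cylinder\<close>).

  Both paths end at their first visit to the empty book. Each is treated as a sequence that
  moves to \<open>None\<close> afterwards (\<open>killed\<close>). The Markov property of the order book gives the same
  recursion for its finite-dimensional laws (\<open>lob_chain_cylinder\<close>), and these determine the law on
  path space. As the tree-valued variable may take arbitrary values in \<open>trees\<close> on a null set,
  measurability of \<open>Phi\<close> and \<open>Gamma_book\<close> is shown on the whole space of trees.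
\<close>


section \<open>Measurability of the operations on books\<close>

lemma space_book_space [simp]: "space book_space = UNIV"
  by (simp add: book_space_def)

lemma measurable_mass [measurable]:
  assumes "A \<in> sets borel"
  shows "(\<lambda>\<beta>. mass \<beta> A) \<in> book_space \<rightarrow>\<^sub>M count_space UNIV"
proof (rule measurable_count_space_eq2_countable[THEN iffD2], safe)
  show "(\<lambda>\<beta>. mass \<beta> A) -` {k} \<inter> space book_space \<in> sets book_space" for k
    using assms by (auto simp: book_space_def vimage_def)
qed auto

lemma measurable_book_spaceI:
  assumes "\<And>A. A \<in> sets borel \<Longrightarrow> (\<lambda>x. mass (f x) A) \<in> M \<rightarrow>\<^sub>M count_space UNIV"
  shows "f \<in> M \<rightarrow>\<^sub>M book_space"
  unfolding book_space_def
proof (rule measurable_measure_of)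
  fix C assume "C \<in> {{\<beta>. mass \<beta> A = k} |A k. A \<in> sets borel}"
  then obtain A k where C: "C = {\<beta>. mass \<beta> A = k}" and A: "A \<in> sets borel" by auto
  have "f -` C \<inter> space M = (\<lambda>x. mass (f x) A) -` {k} \<inter> space M" by (auto simp: C)
  then show "f -` C \<inter> space M \<in> sets M"
    using measurable_sets[OF assms[OF A], of "{k}"] by simp
qed auto

lemma mass_add_mset: "mass (add_mset x \<beta>) A = (if x \<in> A then 1 else 0) + mass \<beta> A"
  by (simp add: mass_def)

lemma mass_UNIV_eq_0 [simp]: "mass \<beta> UNIV = 0 \<longleftrightarrow> \<beta> = {#}"
  by (simp add: mass_def)

lemma pred_book_empty [measurable]: "Measurable.pred book_space (\<lambda>\<beta>. \<beta> = {#})"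
proof -
  have "Measurable.pred book_space (\<lambda>\<beta>. mass \<beta> UNIV = 0)" by measurable
  then show ?thesis by simp
qed

lemma price_in: "\<beta> \<noteq> {#} \<Longrightarrow> price \<beta> \<in># \<beta>"
  using Max_in[of "set_mset \<beta>"] by (simp add: price_def)

lemma mass_remove_price:
  "mass (\<beta> - {#price \<beta>#}) A = mass \<beta> A - (if \<beta> \<noteq> {#} \<and> price \<beta> \<in> A then 1 else 0)"
proof (cases "\<beta> = {#}")
  case False
  then obtain \<beta>' where "\<beta> = add_mset (price \<beta>) \<beta>'" by (meson multi_member_split price_in)
  then have "mass \<beta> A = (if price \<beta> \<in> A then 1 else 0) + mass (\<beta> - {#price \<beta>#}) A"
    by (metis add_mset_remove_trivial mass_add_mset)
  then show ?thesis using False by simp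
qed (simp add: mass_def)

lemma mass_eq_0_iff: "mass \<beta> A = 0 \<longleftrightarrow> (\<forall>x\<in>#\<beta>. x \<notin> A)"
  by (induction \<beta>) (auto simp: mass_def)

lemma price_le_iff:
  "price \<beta> \<le> a \<longleftrightarrow> (if \<beta> = {#} then 0 \<le> a else mass \<beta> {a<..} = 0)"
  by (auto simp: price_def mass_eq_0_iff not_less)

lemma measurable_price [measurable]: "price \<in> borel_measurable book_space"
proof (rule borel_measurableI_le)
  fix a
  have "Measurable.pred book_space (\<lambda>\<beta>. if \<beta> = {#} then 0 \<le> a else mass \<beta> {a<..} = 0)"
    by measurable
  then show "{\<beta> \<in> space book_space. price \<beta> \<le> a} \<in> sets book_space"
    by (simp add: price_le_iff pred_def)
qed

lemma measurable_add_book: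
  assumes [measurable]: "f \<in> M \<rightarrow>\<^sub>M book_space" "g \<in> borel_measurable M"
  shows "(\<lambda>x. add_mset (g x) (f x)) \<in> M \<rightarrow>\<^sub>M book_space"
proof (rule measurable_book_spaceI)
  fix A :: "real set" assume [measurable]: "A \<in> sets borel"
  have [measurable]: "(\<lambda>x. mass (f x) A) \<in> M \<rightarrow>\<^sub>M count_space UNIV"
    by (rule measurable_compose[OF assms(1)]) measurable
  show "(\<lambda>x. mass (add_mset (g x) (f x)) A) \<in> M \<rightarrow>\<^sub>M count_space UNIV"
    unfolding mass_add_mset by measurable
qed

lemma measurable_remove_price:
  "(\<lambda>\<beta>. \<beta> - {#price \<beta>#}) \<in> book_space \<rightarrow>\<^sub>M book_space"
proof (rule measurable_book_spaceI)
  fix A :: "real set" assume [measurable]: "A \<in> sets borel"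
  show "(\<lambda>\<beta>. mass (\<beta> - {#price \<beta>#}) A) \<in> book_space \<rightarrow>\<^sub>M count_space UNIV"
    unfolding mass_remove_price by measurable
qed

lemma measurable_lob_step:
  assumes "prob_space N" and [measurable]: "X \<in> borel_measurable N"
    and [measurable]: "f \<in> borel_measurable book_space"
  shows "lob_step p N X f \<in> borel_measurable book_space"
proof -
  interpret prob_space N by fact
  have "lob_step p N X f =
      (\<lambda>\<beta>. if \<beta> = {#} then f {#0#}
          else ennreal p * (\<integral>\<^sup>+ \<omega>. f (add_mset (price \<beta> + X \<omega>) \<beta>) \<partial>N)
               + ennreal (1 - p) * f (\<beta> - {#price \<beta>#}))"
    by (intro ext) (simp add: lob_step_def)
  also have "\<dots> \<in> borel_measurable book_space"
  proof -
    have "(\<lambda>x. f (add_mset (price (fst x) + X (snd x)) (fst x)))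
        \<in> borel_measurable (book_space \<Otimes>\<^sub>M N)"
      by (rule measurable_compose[OF measurable_add_book assms(3)]) measurable
    then have [measurable]: "(\<lambda>\<beta>. \<integral>\<^sup>+ \<omega>. f (add_mset (price \<beta> + X \<omega>) \<beta>) \<partial>N)
        \<in> borel_measurable book_space"
      by (intro borel_measurable_nn_integral) (simp add: split_beta')
    have [measurable]: "(\<lambda>\<beta>. f (\<beta> - {#price \<beta>#})) \<in> borel_measurable book_space"
      by (rule measurable_compose[OF measurable_remove_price assms(3)])
    show ?thesis by measurable
  qed
  finally show ?thesis .
qed


section \<open>Processes killed after their first visit to the empty book\<close>

lemma space_option_space: "space (option_space S) = insert None (Some ` space S)"
  unfolding option_space_def by (rule space_measure_of) (use sets.sets_into_space in blast)

lemma sets_option_space: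
  "sets (option_space S)
    = sigma_sets (insert None (Some ` space S)) (insert {None} {Some ` A | A. A \<in> sets S})"
  unfolding option_space_def by (rule sets_measure_of) (use sets.sets_into_space in blast)

lemma None_sets_option_space: "{None} \<in> sets (option_space S)"
  unfolding sets_option_space by (intro sigma_sets.Basic) auto

lemma Some_sets_option_space: "A \<in> sets S \<Longrightarrow> Some ` A \<in> sets (option_space S)"
  unfolding sets_option_space by (intro sigma_sets.Basic) auto

lemma measurable_option_space_If:
  assumes [measurable]: "Measurable.pred M P" "b \<in> M \<rightarrow>\<^sub>M S"
  shows "(\<lambda>x. if P x then Some (b x) else None) \<in> M \<rightarrow>\<^sub>M option_space S"
  unfolding option_space_def
proof (rule measurable_measure_of)
  fix C assume "C \<in> insert {None} {Some ` A |A. A \<in> sets S}"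
  then consider "C = {None}" | A where "C = Some ` A" and "A \<in> sets S" by auto
  then show "(\<lambda>x. if P x then Some (b x) else None) -` C \<inter> space M \<in> sets M"
  proof cases
    case 1
    then have "(\<lambda>x. if P x then Some (b x) else None) -` C \<inter> space M = {x \<in> space M. \<not> P x}"
      by auto
    then show ?thesis by simp
  next
    case 2
    then have "(\<lambda>x. if P x then Some (b x) else None) -` C \<inter> space M
        = {x \<in> space M. P x} \<inter> (b -` A \<inter> space M)"
      by (auto split: if_splits)
    then show ?thesis using \<open>A \<in> sets S\<close> by simp
  qed
next
  show "(\<lambda>x. if P x then Some (b x) else None) \<in> space M \<rightarrow> insert None (Some ` space S)"
    using assms(2)[THEN measurable_space] by auto
next
  show "insert {None} {Some ` A |A. A \<in> sets S} \<subseteq> Pow (insert None (Some ` space S))"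
    using sets.sets_into_space by blast
qed

lemma measurable_Some [measurable]: "Some \<in> S \<rightarrow>\<^sub>M option_space S"
  using measurable_option_space_If[where M = S and P = "\<lambda>_. True" and b = "\<lambda>x. x" and S = S] by simp

lemma measurable_from_option_space:
  assumes "(\<lambda>x. h (Some x)) \<in> S \<rightarrow>\<^sub>M R" and "h None \<in> space R"
  shows "h \<in> option_space S \<rightarrow>\<^sub>M R"
proof (rule measurableI)
  show "h x \<in> space R" if "x \<in> space (option_space S)" for x
    using that assms(2) measurable_space[OF assms(1)] by (auto simp: space_option_space)
  fix A assume A: "A \<in> sets R"
  have "h -` A \<inter> space (option_space S)
      = (if h None \<in> A then {None} else {}) \<union> Some ` ((\<lambda>x. h (Some x)) -` A \<inter> space S)"
    by (auto simp: space_option_space)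
  also have "\<dots> \<in> sets (option_space S)"
    using measurable_sets[OF assms(1) A]
    by (intro sets.Un Some_sets_option_space) (auto simp: None_sets_option_space)
  finally show "h -` A \<inter> space (option_space S) \<in> sets (option_space S)" .
qed

text \<open>
  The path of a book-valued sequence up to and including its first visit to the empty book; it is
  \<open>None\<close> afterwards.
\<close>

definition killed :: "(nat \<Rightarrow> book) \<Rightarrow> nat \<Rightarrow> book option" where
  "killed b = up_to (tau b) b"

lemma enat_le_tau_iff: "enat n \<le> tau b \<longleftrightarrow> (\<forall>i<n. b i \<noteq> {#})"
proof -
  have "enat n \<le> tau b \<longleftrightarrow> (\<forall>i. b i = {#} \<longrightarrow> n \<le> i)"
    unfolding tau_def le_Inf_iff by auto
  then show ?thesis by (auto simp: not_le[symmetric])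
qed

lemma killed_eq: "killed b n = (if \<forall>i<n. b i \<noteq> {#} then Some (b n) else None)"
  by (simp add: killed_def up_to_def enat_le_tau_iff)

lemma killed_0 [simp]: "killed b 0 = Some (b 0)"
  by (simp add: killed_eq)

lemma killed_Suc: "killed b (Suc n) = (if b 0 = {#} then None else killed (\<lambda>i. b (Suc i)) n)"
  by (auto simp: killed_eq less_Suc_eq_0_disj)

lemma killed_Suc': "killed b (Suc n) = (if killed b n \<in> {None, Some {#}} then None else Some (b (Suc n)))"
  by (auto simp: killed_eq less_Suc_eq split: if_splits)

lemma measurable_killed:
  assumes "\<And>i. i \<le> n \<Longrightarrow> (\<lambda>\<omega>. b \<omega> i) \<in> M \<rightarrow>\<^sub>M book_space"
  shows "(\<lambda>\<omega>. killed (b \<omega>) n) \<in> M \<rightarrow>\<^sub>M option_space book_space"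
  unfolding killed_eq
proof (rule measurable_option_space_If)
  have "Measurable.pred M (\<lambda>\<omega>. b \<omega> i \<noteq> {#})" if "i < n" for i
    using measurable_compose[OF assms pred_book_empty, of i] that by simp
  then have "Measurable.pred M (\<lambda>\<omega>. \<forall>i\<in>{..<n}. b \<omega> i \<noteq> {#})"
    by (intro pred_intros_finite) auto
  then show "Measurable.pred M (\<lambda>\<omega>. \<forall>i<n. b \<omega> i \<noteq> {#})"
    unfolding Ball_def lessThan_iff .
qed (simp add: assms)


section \<open>Cylinder probabilities of the killed chain\<close>

text \<open>
  The transition operator of the killed chain: in the step after its first visit to the empty book
  it is sent to the absorbing state \<open>None\<close>, whereas the order book restarts from the Dirac mass
  at zero.
\<close>

definition killed_step ::
    "real \<Rightarrow> 'b measure \<Rightarrow> ('b \<Rightarrow> real) \<Rightarrow> (book option \<Rightarrow> ennreal) \<Rightarrow> book option \<Rightarrow> ennreal" where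
  "killed_step p N X h y =
     (case y of None \<Rightarrow> h None
      | Some \<beta> \<Rightarrow> if \<beta> = {#} then h None else lob_step p N X (\<lambda>\<beta>. h (Some \<beta>)) \<beta>)"

text \<open>
  The probability that the killed chain started at \<open>y\<close> is in \<open>A i\<close> at each time \<open>i \<le> n\<close>,
  by recursion on the first step.
\<close>

primrec cylinder_prob ::
    "real \<Rightarrow> 'b measure \<Rightarrow> ('b \<Rightarrow> real) \<Rightarrow> nat \<Rightarrow> (nat \<Rightarrow> book option set) \<Rightarrow> book option \<Rightarrow> ennreal" where
  "cylinder_prob p N X 0 A y = indicator (A 0) y"
| "cylinder_prob p N X (Suc n) A y =
     indicator (A 0) y * killed_step p N X (cylinder_prob p N X n (\<lambda>i. A (Suc i))) y"

lemma measurable_killed_step: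
  assumes "prob_space N" "X \<in> borel_measurable N"
    and h: "h \<in> borel_measurable (option_space book_space)"
  shows "killed_step p N X h \<in> borel_measurable (option_space book_space)"
proof (rule measurable_from_option_space)
  have [measurable]: "lob_step p N X (\<lambda>\<beta>. h (Some \<beta>)) \<in> borel_measurable book_space"
    by (intro measurable_lob_step assms measurable_compose[OF measurable_Some h])
  show "(\<lambda>\<beta>. killed_step p N X h (Some \<beta>)) \<in> borel_measurable book_space"
    unfolding killed_step_def option.case by measurable
qed simp

lemma measurable_cylinder_prob:
  assumes "prob_space N" "X \<in> borel_measurable N"
    and "\<And>i. A i \<in> sets (option_space book_space)"
  shows "cylinder_prob p N X n A \<in> borel_measurable (option_space book_space)"
  using assms(3)
proof (induction n arbitrary: A)
  case 0
  have [measurable]: "A 0 \<in> sets (option_space book_space)" by (rule 0)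
  show ?case unfolding cylinder_prob.simps[abs_def] by measurable
next
  case (Suc n)
  have [measurable]: "A 0 \<in> sets (option_space book_space)"
    "killed_step p N X (cylinder_prob p N X n (\<lambda>i. A (Suc i))) \<in> borel_measurable (option_space book_space)"
    by (intro Suc measurable_killed_step assms(1,2))+
  show ?case unfolding cylinder_prob.simps[abs_def] by measurable
qed

lemma killed_step_le_1:
  assumes "0 \<le> p" "p \<le> 1" "prob_space N" and h: "\<And>y. h y \<le> 1"
  shows "killed_step p N X h y \<le> 1"
proof -
  interpret prob_space N by fact
  have "(\<integral>\<^sup>+ \<omega>. h (Some (\<beta> + {#price \<beta> + X \<omega>#})) \<partial>N) \<le> (\<integral>\<^sup>+ \<omega>. 1 \<partial>N)" for \<beta>
    by (intro nn_integral_mono h)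
  then have "ennreal p * (\<integral>\<^sup>+ \<omega>. h (Some (\<beta> + {#price \<beta> + X \<omega>#})) \<partial>N)
        + ennreal (1 - p) * h (Some (\<beta> - {#price \<beta>#})) \<le> ennreal p * 1 + ennreal (1 - p) * 1" for \<beta>
    by (intro add_mono mult_left_mono h) (simp_all add: emeasure_space_1)
  also have "ennreal p * 1 + ennreal (1 - p) * 1 = 1"
    using assms(1,2) by (simp flip: ennreal_plus)
  finally show ?thesis
    by (auto simp: killed_step_def lob_step_def h split: option.split)
qed

lemma cylinder_prob_le_1:
  assumes "0 \<le> p" "p \<le> 1" "prob_space N"
  shows "cylinder_prob p N X n A y \<le> 1"
proof (induction n arbitrary: A y)
  case 0
  show ?case by (simp add: indicator_def)
next
  case (Suc n)
  show ?case
    using killed_step_le_1[OF assms Suc] by (simp add: indicator_def)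
qed

lemma cylinder_prob_None:
  "cylinder_prob p N X n A None = (\<Prod>i\<le>n. indicator (A i) None)"
  by (induction n arbitrary: A) (simp_all add: killed_step_def prod.atMost_Suc_shift del: prod.atMost_Suc)


section \<open>The law of the killed order book\<close>

lemma subalgebra_history:
  assumes "\<And>n. B n \<in> M \<rightarrow>\<^sub>M book_space"
  shows "subalgebra M (history M B n)"
proof -
  have "sets (history M B n) \<subseteq> sets M"
    unfolding history_def using assms
    by (subst sets_measure_of) (auto intro!: sets.sigma_sets_subset measurable_sets)
  moreover have "space (history M B n) = space M"
    unfolding history_def by (rule space_measure_of) auto
  ultimately show ?thesis by (simp add: subalgebra_def)
qed

lemma measurable_history:
  assumes "i \<le> n"
  shows "B i \<in> history M B n \<rightarrow>\<^sub>M book_space"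
proof (rule measurableI)
  have sp: "space (history M B n) = space M"
    unfolding history_def by (rule space_measure_of) auto
  show "B i -` A \<inter> space (history M B n) \<in> sets (history M B n)" if "A \<in> sets book_space" for A
    unfolding sp unfolding history_def using assms that
    by (subst sets_measure_of) (auto intro!: sigma_sets.Basic)
qed simp

text \<open>The Markov property of the killed chain, tested against a function of the past.\<close>

lemma lob_chain_killed_step:
  fixes M :: "'c measure"
  assumes N: "prob_space N" "X \<in> borel_measurable N"
    and B: "lob_chain p N X M B"
    and h: "h \<in> borel_measurable (option_space book_space)" "\<And>y. h y \<le> 1"
    and W: "W \<in> borel_measurable (history M B k)"
  shows "(\<integral>\<^sup>+ \<omega>. W \<omega> * killed_step p N X h (killed (\<lambda>n. B n \<omega>) k) \<partial>M)
       = (\<integral>\<^sup>+ \<omega>. W \<omega> * h (killed (\<lambda>n. B n \<omega>) (Suc k)) \<partial>M)"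
proof -
  interpret M: prob_space M using B by (simp add: lob_chain_def)
  have B_meas [measurable]: "B n \<in> M \<rightarrow>\<^sub>M book_space" for n
    using B by (simp add: lob_chain_def)
  let ?F = "history M B k"
  interpret finite_measure_subalgebra M ?F
    by standard (rule subalgebra_history[OF B_meas])
  have from_F: "g \<in> borel_measurable M" if "g \<in> borel_measurable ?F" for g :: "'c \<Rightarrow> ennreal"
    by (rule measurable_from_subalg[OF subalg that])
  define f where "f = (\<lambda>\<beta>. h (Some \<beta>))"
  have f [measurable]: "f \<in> borel_measurable book_space"
    unfolding f_def by (rule measurable_compose[OF measurable_Some h(1)])
  have f_fin: "f \<beta> < \<infinity>" for \<beta>
    using h(2)[of "Some \<beta>"] by (simp add: f_def less_top[symmetric] top.extremum_strict)
       (metis ennreal_one_less_top leD top.not_eq_extremum)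
  have [measurable]: "lob_step p N X f \<in> borel_measurable book_space"
    by (rule measurable_lob_step[OF N f])
  \<comment> \<open>the event that no book is empty up to time \<open>k\<close>, so that the killed chain takes a genuine
    step of the order book; on its complement the next state is \<open>None\<close>\<close>
  define D where "D \<omega> \<longleftrightarrow> (\<forall>i\<in>{..k}. B i \<omega> \<noteq> {#})" for \<omega>
  have D [measurable]: "Measurable.pred ?F D"
    unfolding D_def[abs_def]
    by (intro pred_intros_finite finite_atMost pred_intros_logic
        measurable_compose[OF measurable_history pred_book_empty]) simp
  define U where "U \<omega> = (if D \<omega> then W \<omega> else 0)" for \<omega>
  define V where "V \<omega> = (if D \<omega> then 0 else W \<omega> * h None)" for \<omega>
  note W [measurable]
  have UF: "U \<in> borel_measurable ?F" and VF: "V \<in> borel_measurable ?F"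
    unfolding U_def[abs_def] V_def[abs_def] by measurable
  note [measurable] = from_F[OF UF] from_F[OF VF]
  have kk: "killed (\<lambda>n. B n \<omega>) k = Some (B k \<omega>)" "B k \<omega> \<noteq> {#}" if "D \<omega>" for \<omega>
    using that by (auto simp: D_def killed_eq)
  have kn: "killed (\<lambda>n. B n \<omega>) k \<in> {None, Some {#}}" if "\<not> D \<omega>" for \<omega>
    using that by (auto simp: D_def killed_eq le_less)
  have 1: "W \<omega> * killed_step p N X h (killed (\<lambda>n. B n \<omega>) k)
      = U \<omega> * lob_step p N X f (B k \<omega>) + V \<omega>" for \<omega>
    using kk[of \<omega>] kn[of \<omega>] by (cases "D \<omega>") (auto simp: U_def V_def killed_step_def f_def)
  have 2: "W \<omega> * h (killed (\<lambda>n. B n \<omega>) (Suc k)) = U \<omega> * f (B (Suc k) \<omega>) + V \<omega>" for \<omega>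
    using kk[of \<omega>] kn[of \<omega>] by (cases "D \<omega>") (auto simp: U_def V_def killed_Suc' f_def)
  have "AE \<omega> in M. nn_cond_exp M ?F (\<lambda>\<omega>. f (B (Suc k) \<omega>)) \<omega> = lob_step p N X f (B k \<omega>)"
    using B f f_fin unfolding lob_chain_def by blast
  then have "(\<integral>\<^sup>+ \<omega>. U \<omega> * lob_step p N X f (B k \<omega>) \<partial>M)
      = (\<integral>\<^sup>+ \<omega>. U \<omega> * nn_cond_exp M ?F (\<lambda>\<omega>. f (B (Suc k) \<omega>)) \<omega> \<partial>M)"
    by (intro nn_integral_cong_AE) auto
  also have "\<dots> = (\<integral>\<^sup>+ \<omega>. U \<omega> * f (B (Suc k) \<omega>) \<partial>M)"
    by (rule nn_cond_exp_intg[OF UF]) measurable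
  finally show ?thesis
    unfolding 1 2 by (simp add: nn_integral_add)
qed

lemma lob_chain_cylinder:
  assumes p: "0 \<le> p" "p \<le> 1" and N: "prob_space N" "X \<in> borel_measurable N"
    and B: "lob_chain p N X M B" and B0: "AE \<omega> in M. B 0 \<omega> = \<beta>"
    and A: "\<And>i. A i \<in> sets (option_space book_space)"
  shows "(\<integral>\<^sup>+ \<omega>. (\<Prod>i\<le>n. indicator (A i) (killed (\<lambda>n. B n \<omega>) i)) \<partial>M)
       = cylinder_prob p N X n A (Some \<beta>)"
proof -
  interpret M: prob_space M using B by (simp add: lob_chain_def)
  let ?Y = "\<lambda>\<omega>. killed (\<lambda>n. B n \<omega>)"
  \<comment> \<open>the factors from index \<open>k\<close> on may be replaced by their conditional expectation given the
    state at time \<open>k\<close>\<close>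
  have *: "(\<integral>\<^sup>+ \<omega>. (\<Prod>i<k. indicator (A i) (?Y \<omega> i))
        * cylinder_prob p N X n (\<lambda>i. A (k + i)) (?Y \<omega> k) \<partial>M)
      = (\<integral>\<^sup>+ \<omega>. (\<Prod>i\<le>k + n. indicator (A i) (?Y \<omega> i)) \<partial>M)" for k
  proof (induction n arbitrary: k)
    case 0
    show ?case by (simp add: lessThan_Suc_atMost[symmetric] del: lessThan_Suc_atMost)
  next
    case (Suc n)
    let ?h = "cylinder_prob p N X n (\<lambda>i. A (Suc k + i))"
    let ?W = "\<lambda>\<omega>. \<Prod>i<Suc k. indicator (A i) (?Y \<omega> i) :: ennreal"
    have W: "?W \<in> borel_measurable (history M B k)"
    proof (rule borel_measurable_prod_ennreal)
      fix i assume "i \<in> {..<Suc k}"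
      then have "(\<lambda>\<omega>. ?Y \<omega> i) \<in> history M B k \<rightarrow>\<^sub>M option_space book_space"
        by (intro measurable_killed measurable_history) simp
      then show "(\<lambda>\<omega>. indicator (A i) (?Y \<omega> i) :: ennreal) \<in> borel_measurable (history M B k)"
        by (rule measurable_compose) (rule borel_measurable_indicator[OF A])
    qed
    have "(\<integral>\<^sup>+ \<omega>. (\<Prod>i<k. indicator (A i) (?Y \<omega> i))
        * cylinder_prob p N X (Suc n) (\<lambda>i. A (k + i)) (?Y \<omega> k) \<partial>M)
      = (\<integral>\<^sup>+ \<omega>. ?W \<omega> * killed_step p N X ?h (?Y \<omega> k) \<partial>M)"
      by (simp add: ac_simps)
    also have "\<dots> = (\<integral>\<^sup>+ \<omega>. ?W \<omega> * ?h (?Y \<omega> (Suc k)) \<partial>M)"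
      by (intro lob_chain_killed_step N B W measurable_cylinder_prob cylinder_prob_le_1 p A)
    also have "\<dots> = (\<integral>\<^sup>+ \<omega>. (\<Prod>i\<le>Suc k + n. indicator (A i) (?Y \<omega> i)) \<partial>M)"
      by (rule Suc.IH)
    finally show ?case by simp
  qed
  have "(\<integral>\<^sup>+ \<omega>. (\<Prod>i\<le>n. indicator (A i) (?Y \<omega> i)) \<partial>M)
      = (\<integral>\<^sup>+ \<omega>. cylinder_prob p N X n A (Some (B 0 \<omega>)) \<partial>M)"
    using *[of 0] by simp
  also have "\<dots> = (\<integral>\<^sup>+ \<omega>. cylinder_prob p N X n A (Some \<beta>) \<partial>M)"
    using B0 by (intro nn_integral_cong_AE) auto
  finally show ?thesis by (simp add: M.emeasure_space_1)
qed


section \<open>The distinguished green node and the operator\<close>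

lemma treesD:
  assumes "t \<in> trees"
  shows "[] \<in> nodes t" "v @ [i] \<in> nodes t \<Longrightarrow> v \<in> nodes t" "finite (green t)"
proof -
  have "ulam_harris (nodes t)" "finite {v \<in> nodes t. color t v \<in> {Green, Red}}"
    using assms by (auto simp: trees_def)
  moreover have "green t \<subseteq> {v \<in> nodes t. color t v \<in> {Green, Red}}"
    by (auto simp: green_def)
  ultimately show "[] \<in> nodes t" "v @ [i] \<in> nodes t \<Longrightarrow> v \<in> nodes t" "finite (green t)"
    unfolding ulam_harris_def by (blast, blast, blast intro: finite_subset)
qed

text \<open>The total order on nodes by label, ties being broken by the lexicographical order.\<close>

definition precedes :: "ltree \<Rightarrow> nat list \<Rightarrow> nat list \<Rightarrow> bool" where
  "precedes t u v \<longleftrightarrow>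
     label u t < label v t \<or> (label u t = label v t \<and> (u = v \<or> (u, v) \<in> lexord less_than))"

text \<open>
  The property that determines \<open>gamma_node t\<close>: being the greatest green node. As a predicate it
  is also meaningful for trees without green nodes, where no node satisfies it.
\<close>

definition is_gamma :: "ltree \<Rightarrow> nat list \<Rightarrow> bool" where
  "is_gamma t v \<longleftrightarrow> v \<in> green t \<and> (\<forall>u\<in>green t. precedes t u v)"

lemma precedes_linear: "precedes t u v \<or> precedes t v u"
proof -
  have "(u, v) \<in> lexord less_than \<or> u = v \<or> (v, u) \<in> lexord less_than"
    by (rule lexord_linear) auto
  then show ?thesis by (auto simp: precedes_def)
qed

lemma precedes_trans: "precedes t u v \<Longrightarrow> precedes t v w \<Longrightarrow> precedes t u w"
  using lexord_trans[of u v less_than w] by (auto simp: precedes_def)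

lemma precedes_antisym: "precedes t u v \<Longrightarrow> precedes t v u \<Longrightarrow> u = v"
  using asymD[OF lexord_asym[OF asym_less_than]] by (auto simp: precedes_def)

lemma is_gamma_unique: "is_gamma t u \<Longrightarrow> is_gamma t v \<Longrightarrow> u = v"
  unfolding is_gamma_def by (metis precedes_antisym)

lemma gamma_node_eqI: "is_gamma t v \<Longrightarrow> gamma_node t = v"
  unfolding gamma_node_def precedes_def[symmetric] is_gamma_def[symmetric]
  by (rule the_equality) (auto intro: is_gamma_unique)

lemma is_gamma_gamma_node:
  assumes "finite (green t)" "green t \<noteq> {}"
  shows "is_gamma t (gamma_node t)"
proof -
  have "\<exists>v\<in>S. \<forall>u\<in>S. precedes t u v" if "finite S" "S \<noteq> {}" for S
    using that
  proof (induction S rule: finite_ne_induct)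
    case (singleton x)
    then show ?case by (simp add: precedes_def)
  next
    case (insert x F)
    then obtain v where v: "v \<in> F" "\<forall>u\<in>F. precedes t u v" by blast
    show ?case
    proof (cases "precedes t x v")
      case True
      with v show ?thesis by blast
    next
      case False
      then have "precedes t v x" using precedes_linear by blast
      with v(2) have "\<forall>u\<in>insert x F. precedes t u x"
        by (auto intro: precedes_trans simp: precedes_def[of t x x])
      then show ?thesis by blast
    qed
  qed
  from this[OF assms] obtain v where "is_gamma t v" by (auto simp: is_gamma_def)
  then show ?thesis by (simp add: gamma_node_eqI)
qed

lemma omega_eq_0_iff: "omega t = 0 \<longleftrightarrow> white_children t (gamma_node t) = {}"
  by (auto simp: omega_def Let_def zero_enat_def)

lemma Phi_no_green: "green t = {} \<Longrightarrow> Phi t = t"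
  by (simp add: Phi_def)

lemma Phi_Green:
  assumes "is_gamma t v" "v @ [i] \<in> nodes t" "color t (v @ [i]) = White"
    and "\<And>j. v @ [j] \<in> nodes t \<Longrightarrow> color t (v @ [j]) = White \<Longrightarrow> i \<le> j"
  shows "Phi t = t\<lparr>color := (color t)(v @ [i] := Green)\<rparr>"
proof -
  have "(LEAST j. j \<in> white_children t v) = i"
    using assms by (intro Least_equality) (auto simp: white_children_def)
  moreover have "white_children t v \<noteq> {}" using assms by (auto simp: white_children_def)
  moreover have "green t \<noteq> {}" using assms by (auto simp: is_gamma_def)
  ultimately show ?thesis
    using assms(1) by (simp add: Phi_def omega_eq_0_iff gamma_node_eqI)
qed

lemma Phi_Red:
  assumes "is_gamma t v" "\<And>j. v @ [j] \<in> nodes t \<Longrightarrow> color t (v @ [j]) \<noteq> White"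
  shows "Phi t = t\<lparr>color := (color t)(v := Red)\<rparr>"
proof -
  have "white_children t v = {}" using assms by (auto simp: white_children_def)
  moreover have "green t \<noteq> {}" using assms by (auto simp: is_gamma_def)
  ultimately show ?thesis
    using assms(1) by (simp add: Phi_def omega_eq_0_iff gamma_node_eqI)
qed

lemma Phi_cases [consumes 1, case_names no_green Green Red]:
  assumes "finite (green t)"
  obtains "green t = {}" "Phi t = t"
  | v i where "is_gamma t v" "v @ [i] \<in> nodes t" "color t (v @ [i]) = White"
      "\<And>j. v @ [j] \<in> nodes t \<Longrightarrow> color t (v @ [j]) = White \<Longrightarrow> i \<le> j"
      "Phi t = t\<lparr>color := (color t)(v @ [i] := Green)\<rparr>"
  | v where "is_gamma t v" "\<And>j. v @ [j] \<in> nodes t \<Longrightarrow> color t (v @ [j]) \<noteq> White"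
      "Phi t = t\<lparr>color := (color t)(v := Red)\<rparr>"
proof (cases "green t = {}")
  case True
  then show ?thesis using that(1) by (simp add: Phi_no_green)
next
  case False
  let ?v = "gamma_node t"
  have g: "is_gamma t ?v" by (rule is_gamma_gamma_node[OF assms False])
  show ?thesis
  proof (cases "white_children t ?v = {}")
    case True
    then have w: "\<And>j. ?v @ [j] \<in> nodes t \<Longrightarrow> color t (?v @ [j]) \<noteq> White"
      by (auto simp: white_children_def)
    show ?thesis by (rule that(3)[OF g w Phi_Red[OF g w]])
  next
    case False
    define i where "i = (LEAST j. j \<in> white_children t ?v)"
    from False have "i \<in> white_children t ?v" unfolding i_def by (auto intro: LeastI)
    then have i: "?v @ [i] \<in> nodes t" "color t (?v @ [i]) = White"
      by (auto simp: white_children_def)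
    have j: "i \<le> j" if "?v @ [j] \<in> nodes t" "color t (?v @ [j]) = White" for j
      using that unfolding i_def by (intro Least_le) (auto simp: white_children_def)
    show ?thesis by (rule that(2)[OF g i j Phi_Green[OF g i j]])
  qed
qed

lemma connected_nodes_insert_child:
  assumes S: "connected_nodes S" and v: "v \<in> S"
  shows "connected_nodes (insert (v @ [i]) S)"
proof -
  let ?R = "adjacent \<inter> insert (v @ [i]) S \<times> insert (v @ [i]) S"
  have sub: "(adjacent \<inter> S \<times> S)\<^sup>* \<subseteq> ?R\<^sup>*" by (intro rtrancl_mono) auto
  have e: "(v, v @ [i]) \<in> ?R" "(v @ [i], v) \<in> ?R"
    using v by (auto simp: adjacent_def)
  have to_v: "(a, v) \<in> ?R\<^sup>*" if "a \<in> insert (v @ [i]) S" for a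
    using that S v sub e by (cases "a = v @ [i]") (auto simp: connected_nodes_def)
  have from_v: "(v, a) \<in> ?R\<^sup>*" if "a \<in> insert (v @ [i]) S" for a
    using that S v sub e by (cases "a = v @ [i]") (auto simp: connected_nodes_def)
  show ?thesis
    unfolding connected_nodes_def by (intro ballI rtrancl_trans[OF to_v from_v])
qed

lemma Phi_in_trees:
  assumes t: "t \<in> trees"
  shows "Phi t \<in> trees"
  using treesD(3)[OF t]
proof (cases t rule: Phi_cases)
  case no_green
  with t show ?thesis by simp
next
  case (Green v i)
  let ?C = "\<lambda>t. {v \<in> nodes t. color t v \<in> {Green, Red}}"
  have "?C (Phi t) = insert (v @ [i]) (?C t)" using Green by auto
  moreover have "v \<in> ?C t" using Green(1) by (auto simp: is_gamma_def green_def)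
  ultimately show ?thesis
    using t Green(2) connected_nodes_insert_child[of "?C t" v i]
    by (simp add: trees_def Green(5))
next
  case (Red v)
  have "v \<in> green t" using Red(1) by (simp add: is_gamma_def)
  then have "{w \<in> nodes t. color (Phi t) w \<in> {Green, Red}} = {v \<in> nodes t. color t v \<in> {Green, Red}}"
    using Red by (auto simp: green_def)
  then show ?thesis
    using t by (simp add: trees_def Red(3)) 
qed

lemma Phi_power_in_trees: "t \<in> trees \<Longrightarrow> (Phi ^^ n) t \<in> trees"
  by (induction n) (auto intro: Phi_in_trees)

lemma Gamma_book_eq_empty_iff: "t \<in> trees \<Longrightarrow> Gamma_book t = {#} \<longleftrightarrow> green t = {}"
  using treesD(3)[of t] by (simp add: Gamma_book_def mset_set_empty_iff)

lemma up_to_kappa: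
  assumes "t \<in> trees"
  shows "up_to (kappa t) (\<lambda>n. Gamma_book ((Phi ^^ n) t)) = killed (\<lambda>n. Gamma_book ((Phi ^^ n) t))"
proof -
  have "kappa t = tau (\<lambda>n. Gamma_book ((Phi ^^ n) t))"
    by (simp add: kappa_def tau_def Gamma_book_eq_empty_iff[OF Phi_power_in_trees[OF assms]])
  then show ?thesis by (simp add: killed_def)
qed


section \<open>Measurability on the space of trees\<close>

text \<open>The family of sets by which the sigma-algebra on trees is generated.\<close>

abbreviation tree_generator :: "ltree set set" where
  "tree_generator \<equiv>
     {{t \<in> trees. v \<in> nodes t} | v. True}
      \<union> {{t \<in> trees. root_label t \<in> A} | A. A \<in> sets borel}
      \<union> {{t \<in> trees. v \<in> nodes t \<and> edge_label t v \<in> A} | v A. v \<noteq> [] \<and> A \<in> sets borel}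
      \<union> {{t \<in> trees. v \<in> nodes t \<and> color t v = c} | v c. True}"

lemma space_tree_space [simp]: "space tree_space = trees"
  unfolding tree_space_def by (rule space_measure_of) blast

lemma sets_tree_space: "sets tree_space = sigma_sets trees tree_generator"
  unfolding tree_space_def by (rule sets_measure_of) blast

lemma pred_nodes [measurable]: "Measurable.pred tree_space (\<lambda>t. v \<in> nodes t)"
proof -
  have "{t \<in> trees. v \<in> nodes t} \<in> tree_generator" by blast
  then show ?thesis by (simp add: pred_def sets_tree_space sigma_sets.Basic)
qed

lemma pred_color [measurable]:
  "Measurable.pred tree_space (\<lambda>t. v \<in> nodes t \<and> color t v = c)"
proof -
  have "{t \<in> trees. v \<in> nodes t \<and> color t v = c} \<in> tree_generator" by blast
  then show ?thesis unfolding pred_def sets_tree_space space_tree_space by (rule sigma_sets.Basic)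
qed

lemma pred_green [measurable]: "Measurable.pred tree_space (\<lambda>t. v \<in> green t)"
  unfolding green_def mem_Collect_eq by measurable

lemma measurable_root_label [measurable]: "root_label \<in> borel_measurable tree_space"
proof (rule measurableI)
  fix A :: "real set" assume "A \<in> sets borel"
  then have "{t \<in> trees. root_label t \<in> A} \<in> tree_generator" by blast
  moreover have "root_label -` A \<inter> trees = {t \<in> trees. root_label t \<in> A}" by auto
  ultimately show "root_label -` A \<inter> space tree_space \<in> sets tree_space"
    by (simp only: sets_tree_space space_tree_space sigma_sets.Basic)
qed simp

lemma pred_edge_label:
  assumes "v \<noteq> []" "A \<in> sets borel"
  shows "Measurable.pred tree_space (\<lambda>t. v \<in> nodes t \<and> edge_label t v \<in> A)"
proof -
  have "{t \<in> trees. v \<in> nodes t \<and> edge_label t v \<in> A} \<in> tree_generator" using assms by blast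
  then show ?thesis unfolding pred_def sets_tree_space space_tree_space by (rule sigma_sets.Basic)
qed

lemma measurable_tree_spaceI:
  assumes trees: "\<And>x. x \<in> space M \<Longrightarrow> f x \<in> trees"
    and nodes: "\<And>v. Measurable.pred M (\<lambda>x. v \<in> nodes (f x))"
    and root: "(\<lambda>x. root_label (f x)) \<in> borel_measurable M"
    and edge: "\<And>v A. v \<noteq> [] \<Longrightarrow> A \<in> sets borel \<Longrightarrow>
      Measurable.pred M (\<lambda>x. v \<in> nodes (f x) \<and> edge_label (f x) v \<in> A)"
    and color: "\<And>v c. Measurable.pred M (\<lambda>x. v \<in> nodes (f x) \<and> color (f x) v = c)"
  shows "f \<in> M \<rightarrow>\<^sub>M tree_space"
  unfolding tree_space_def
proof (rule measurable_measure_of)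
  fix C assume C: "C \<in> tree_generator"
  have *: "f -` {t \<in> trees. Q t} \<inter> space M \<in> sets M" if "Measurable.pred M (\<lambda>x. Q (f x))" for Q
  proof -
    have "f -` {t \<in> trees. Q t} \<inter> space M = {x \<in> space M. Q (f x)}" using trees by auto
    then show ?thesis using that by (simp add: pred_def)
  qed
  have "Measurable.pred M (\<lambda>x. root_label (f x) \<in> A)" if "A \<in> sets borel" for A
    using root that by measurable
  with C show "f -` C \<inter> space M \<in> sets M"
    by (elim UnE CollectE exE conjE) (auto simp del: vimage_Collect_eq intro!: * nodes edge color)
next
  show "f \<in> space M \<rightarrow> trees" using trees by auto
qed blast

lemma measurable_edge_label:
  assumes "v \<noteq> []"
  shows "(\<lambda>t. if v \<in> nodes t then edge_label t v else 0) \<in> borel_measurable tree_space" (is "?f \<in> _")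
proof (rule measurableI)
  fix A :: "real set" assume "A \<in> sets borel"
  then have "{t \<in> trees. v \<in> nodes t \<and> edge_label t v \<in> A} \<in> sets tree_space"
    using pred_edge_label[OF assms] by (simp add: pred_def)
  moreover have "{t \<in> space tree_space. v \<notin> nodes t \<and> 0 \<in> A} \<in> sets tree_space" by measurable
  moreover have "?f -` A \<inter> space tree_space = {t \<in> trees. v \<in> nodes t \<and> edge_label t v \<in> A}
      \<union> {t \<in> space tree_space. v \<notin> nodes t \<and> 0 \<in> A}" by (auto split: if_splits)
  ultimately show "?f -` A \<inter> space tree_space \<in> sets tree_space"
    by simp
qed simp

lemma label_Nil [simp]: "label [] t = root_label t"
  by (simp add: label.simps)

lemma label_snoc [simp]: "label (v @ [i]) t = label v t + edge_label t (v @ [i])"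
  by (simp add: label.simps[of "v @ [i]"])

lemma measurable_label [measurable]:
  "(\<lambda>t. if v \<in> nodes t then label v t else 0) \<in> borel_measurable tree_space"
proof (induction v rule: rev_induct)
  case Nil
  have "root_label \<in> borel_measurable tree_space" by measurable
  then show ?case
    by (rule measurable_cong[THEN iffD1, rotated]) (simp add: treesD(1))
next
  case (snoc i v)
  note [measurable] = snoc measurable_edge_label[of "v @ [i]", simplified]
  have "(\<lambda>t. if v @ [i] \<in> nodes t then (if v \<in> nodes t then label v t else 0)
      + (if v @ [i] \<in> nodes t then edge_label t (v @ [i]) else 0) else 0) \<in> borel_measurable tree_space"
    by measurable
  then show ?case
    by (rule measurable_cong[THEN iffD1, rotated]) (auto dest: treesD(2))
qed

lemma pred_is_gamma [measurable]: "Measurable.pred tree_space (\<lambda>t. is_gamma t v)"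
proof -
  let ?l = "\<lambda>v t. if v \<in> nodes t then label v t else 0"
  have "Measurable.pred tree_space (\<lambda>t. v \<in> green t \<and> (\<forall>u. u \<in> green t \<longrightarrow>
      ?l u t < ?l v t \<or> (?l u t = ?l v t \<and> (u = v \<or> (u, v) \<in> lexord less_than))))"
    by measurable
  moreover have "is_gamma t v \<longleftrightarrow> v \<in> green t \<and> (\<forall>u. u \<in> green t \<longrightarrow>
      ?l u t < ?l v t \<or> (?l u t = ?l v t \<and> (u = v \<or> (u, v) \<in> lexord less_than)))" for t
    by (auto simp: is_gamma_def precedes_def green_def)
  ultimately show ?thesis by simp
qed

text \<open>
  The colors of \<open>Phi t\<close> in terms of those of \<open>t\<close>, with quantifiers over countable types only; this
  is what makes \<open>Phi\<close> measurable. The inner conditions single out the first white child of \<open>v\<close>.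
\<close>

lemma color_Phi_iff:
  assumes t: "t \<in> trees"
  defines "P \<equiv> \<lambda>c v. v \<in> nodes t \<and> color t v = c"
  shows "w \<in> nodes (Phi t) \<and> color (Phi t) w = c \<longleftrightarrow>
    ((\<forall>v. v \<notin> green t) \<and> P c w) \<or>
    (\<exists>v. is_gamma t v \<and>
       (if \<exists>i. P White (v @ [i])
        then if \<exists>i. w = v @ [i] \<and> P White w \<and> (\<forall>j<i. \<not> P White (v @ [j])) then c = Green else P c w
        else if w = v then c = Red else P c w))"
  using treesD(3)[OF t]
proof (cases t rule: Phi_cases)
  case no_green
  then show ?thesis by (auto simp: P_def is_gamma_def)
next
  case (Green v i)
  have g: "v \<in> green t" using Green(1) by (simp add: is_gamma_def)
  have only: "is_gamma t v' \<longleftrightarrow> v' = v" for v' using Green(1) is_gamma_unique by blast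
  have "\<exists>i. P White (v @ [i])" using Green by (auto simp: P_def)
  moreover have "(\<exists>i. w = v @ [i] \<and> P White w \<and> (\<forall>j<i. \<not> P White (v @ [j]))) \<longleftrightarrow> w = v @ [i]"
  proof -
    have w: "P White (v @ [i])" and least: "\<And>j. P White (v @ [j]) \<Longrightarrow> i \<le> j"
      using Green(2,3,4) by (auto simp: P_def)
    have "(P White (v @ [k]) \<and> (\<forall>j<k. \<not> P White (v @ [j]))) \<longleftrightarrow> k = i" for k
      using w least[of k] least by (auto intro: le_antisym simp: not_le[symmetric])
    then show ?thesis using w by auto
  qed
  ultimately show ?thesis using g Green(2) unfolding Green(5) only by (auto simp: P_def)
next
  case (Red v)
  have g: "v \<in> green t" using Red(1) by (simp add: is_gamma_def)
  then have "v \<in> nodes t" by (simp add: green_def)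
  have only: "is_gamma t v' \<longleftrightarrow> v' = v" for v' using Red(1) is_gamma_unique by blast
  show ?thesis using g Red(2) \<open>v \<in> nodes t\<close> unfolding Red(3) only by (auto simp: P_def)
qed

lemma measurable_Phi: "Phi \<in> tree_space \<rightarrow>\<^sub>M tree_space"
proof (rule measurable_tree_spaceI)
  have other: "nodes (Phi t) = nodes t" "root_label (Phi t) = root_label t"
    "edge_label (Phi t) = edge_label t" for t
    by (simp_all add: Phi_def)
  show "Measurable.pred tree_space (\<lambda>t. v \<in> nodes (Phi t))" for v
    unfolding other by measurable
  show "(\<lambda>t. root_label (Phi t)) \<in> borel_measurable tree_space"
    unfolding other by measurable
  show "Measurable.pred tree_space (\<lambda>t. v \<in> nodes (Phi t) \<and> edge_label (Phi t) v \<in> A)"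
    if "v \<noteq> []" "A \<in> sets borel" for v A
    unfolding other by (rule pred_edge_label[OF that])
  show "Measurable.pred tree_space (\<lambda>t. v \<in> nodes (Phi t) \<and> color (Phi t) v = c)" for v c
    by (subst measurable_cong[OF color_Phi_iff]) (simp, measurable)
qed (simp add: Phi_in_trees)

lemma measurable_Phi_power: "(Phi ^^ n) \<in> tree_space \<rightarrow>\<^sub>M tree_space"
proof (induction n)
  case (Suc n)
  then show ?case unfolding funpow.simps by (rule measurable_comp[OF _ measurable_Phi])
qed (simp add: id_def)

lemma measurable_Gamma_book: "Gamma_book \<in> tree_space \<rightarrow>\<^sub>M book_space"
proof (rule measurable_book_spaceI)
  fix A :: "real set" assume [measurable]: "A \<in> sets borel"
  let ?l = "\<lambda>v t. if v \<in> nodes t then label v t else 0"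
  \<comment> \<open>the green nodes with label in \<open>A\<close> are counted through an enumeration of all words\<close>
  let ?S = "\<lambda>t. {n. \<exists>v::nat list. n = to_nat v \<and> v \<in> green t \<and> ?l v t \<in> A}"
  have "(\<lambda>t. card (?S t)) \<in> tree_space \<rightarrow>\<^sub>M count_space UNIV"
    unfolding mem_Collect_eq by measurable
  moreover have "mass (Gamma_book t) A = card (?S t)" if "t \<in> trees" for t
  proof -
    have "?S t = to_nat ` {v \<in> green t. label v t \<in> A}" by (auto simp: green_def)
    then have "card (?S t) = card {v \<in> green t. label v t \<in> A}" by (simp add: card_image)
    moreover have "mass (Gamma_book t) A = card {v \<in> green t. label v t \<in> A}"
      using treesD(3)[OF that]
      by (simp add: mass_def Gamma_book_def filter_mset_image_mset filter_mset_mset_set)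
    ultimately show ?thesis by simp
  qed
  ultimately show "(\<lambda>t. mass (Gamma_book t) A) \<in> tree_space \<rightarrow>\<^sub>M count_space UNIV"
    by (subst measurable_cong[where g = "\<lambda>t. card (?S t)"]) auto
qed

lemma measurable_tree_path:
  "(\<lambda>t. killed (\<lambda>n. Gamma_book ((Phi ^^ n) t)) i) \<in> tree_space \<rightarrow>\<^sub>M option_space book_space"
  by (intro measurable_killed measurable_compose[OF measurable_Phi_power measurable_Gamma_book])


section \<open>Completions of an explored tree\<close>

text \<open>
  An explored tree is a finite tree without white nodes. It stands for the coloured part of a
  larger tree, whose white part is still unknown.
\<close>

definition explored :: "ltree \<Rightarrow> bool" where
  "explored s \<longleftrightarrow> s \<in> trees \<and> finite (nodes s) \<and> (\<forall>v\<in>nodes s. color s v \<in> {Green, Red})"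

text \<open>The number of explored children of a node.\<close>

definition num_children :: "ltree \<Rightarrow> nat list \<Rightarrow> nat" where
  "num_children s v = card {i. v @ [i] \<in> nodes s}"

text \<open>
  The number of children of a node in a larger tree, when \<open>K v\<close> counts those that are still
  unknown: a green node has \<open>K v\<close> children besides the explored ones, a red node has no others, and
  a node outside the explored tree has \<open>K v\<close> children.
\<close>

definition total_offspring :: "ltree \<Rightarrow> (nat list \<Rightarrow> enat) \<Rightarrow> nat list \<Rightarrow> enat" where
  "total_offspring s K v =
     (if v \<in> nodes s then enat (num_children s v) + (if color s v = Green then K v else 0) else K v)"

text \<open>
  The completion of an explored tree by white nodes, with offspring numbers given by \<open>K\<close> and edge
  labels by \<open>L\<close>. The meaningless edge label at the root is always taken from \<open>L\<close>, so that an initial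
  tree is, as a record, a completion of its root.
\<close>

definition completion :: "ltree \<Rightarrow> (nat list \<Rightarrow> enat) \<Rightarrow> (nat list \<Rightarrow> real) \<Rightarrow> ltree" where
  "completion s K L =
     \<lparr>nodes = gw_nodes (total_offspring s K), root_label = root_label s,
      edge_label = (\<lambda>v. if v \<in> nodes s \<and> v \<noteq> [] then edge_label s v else L v),
      color = (\<lambda>v. if v \<in> nodes s then color s v else White)\<rparr>"

lemma completion_simps [simp]:
  "nodes (completion s K L) = gw_nodes (total_offspring s K)"
  "root_label (completion s K L) = root_label s"
  "edge_label (completion s K L) v = (if v \<in> nodes s \<and> v \<noteq> [] then edge_label s v else L v)"
  "color (completion s K L) v = (if v \<in> nodes s then color s v else White)"
  by (simp_all add: completion_def)

lemma Nil_in_gw_nodes [simp]: "[] \<in> gw_nodes K"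
  by (simp add: gw_nodes_def)

lemma snoc_in_gw_nodes [simp]:
  "v @ [i] \<in> gw_nodes K \<longleftrightarrow> v \<in> gw_nodes K \<and> 1 \<le> i \<and> enat i \<le> K v"
  by (auto simp: gw_nodes_def nth_append less_Suc_eq all_conj_distrib)

lemma ulam_harris_gw_nodes: "ulam_harris (gw_nodes K)"
  unfolding ulam_harris_def
  by (auto simp del: One_nat_def) (meson enat_ord_simps(1) order_trans)

lemma exploredD:
  assumes "explored s"
  shows "s \<in> trees" "finite (nodes s)" "[] \<in> nodes s" "finite (green s)"
    "v @ [i] \<in> nodes s \<Longrightarrow> v \<in> nodes s" "v \<in> nodes s \<Longrightarrow> color s v \<noteq> White"
    "{v \<in> nodes s. color s v \<in> {Green, Red}} = nodes s" "green s \<subseteq> nodes s"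
  using assms treesD by (auto simp: explored_def green_def)

text \<open>The explored children of a node are its first ones, without gaps.\<close>

lemma explored_children:
  assumes "explored s"
  shows "v @ [i] \<in> nodes s \<longleftrightarrow> 1 \<le> i \<and> i \<le> num_children s v"
proof -
  let ?I = "{i. v @ [i] \<in> nodes s}"
  have UH: "\<forall>v i. v @ [i] \<in> nodes s \<longrightarrow> v \<in> nodes s \<and> 1 \<le> i \<and> (\<forall>j. 1 \<le> j \<and> j \<le> i \<longrightarrow> v @ [j] \<in> nodes s)"
    using exploredD(1)[OF assms] unfolding trees_def ulam_harris_def by blast
  have fin: "finite ?I"
    using finite_vimageI[OF exploredD(2)[OF assms], of "\<lambda>i. v @ [i]"]
    by (simp add: vimage_def inj_def)
  obtain m where "?I = {1..m}"
  proof (cases "?I = {}")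
    case True
    then have "?I = {1..0}" by (simp only: atLeastatMost_empty zero_less_one)
    then show ?thesis by (rule that)
  next
    case False
    have "?I = {1..Max ?I}"
    proof (intro equalityI subsetI)
      fix i assume "i \<in> ?I"
      then show "i \<in> {1..Max ?I}" using UH Max_ge[OF fin, of i] unfolding mem_Collect_eq atLeastAtMost_iff by blast
    next
      fix i assume "i \<in> {1..Max ?I}"
      then show "i \<in> ?I" using UH Max_in[OF fin False] unfolding mem_Collect_eq atLeastAtMost_iff by blast
    qed
    then show ?thesis by (rule that)
  qed
  then have "?I = {1..num_children s v}" by (simp add: num_children_def)
  then show ?thesis by (auto simp: set_eq_iff)
qed

lemma nodes_subset_completion:
  assumes "explored s" "v \<in> nodes s"
  shows "v \<in> gw_nodes (total_offspring s K)"
  using assms(2)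
proof (induction v rule: rev_induct)
  case (snoc i v)
  have v: "v \<in> nodes s" using exploredD(5)[OF assms(1) snoc.prems] .
  have "enat i \<le> enat (num_children s v) + k" for k
    using snoc.prems unfolding explored_children[OF assms(1)]
    by (metis enat_ord_simps(1) le_iff_add order_trans)
  then show ?case
    using snoc v unfolding explored_children[OF assms(1)]
    by (auto simp: total_offspring_def)
qed simp

lemma completion_in_trees:
  assumes "explored s"
  shows "completion s K L \<in> trees"
proof -
  have "{v \<in> gw_nodes (total_offspring s K). color (completion s K L) v \<in> {Green, Red}} = nodes s"
    using exploredD(6)[OF assms] nodes_subset_completion[OF assms]
    by (auto split: if_splits intro: color.exhaust)
  moreover have "connected_nodes (nodes s)" "color s [] \<in> {Green, Red}"
    using exploredD(1,7)[OF assms] by (auto simp: trees_def)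
  ultimately show ?thesis
    using exploredD(2,3)[OF assms] by (simp add: trees_def ulam_harris_gw_nodes)
qed

lemma green_completion: "explored s \<Longrightarrow> green (completion s K L) = green s"
  using nodes_subset_completion by (auto simp: green_def split: if_splits)

lemma label_completion:
  assumes "explored s" "v \<in> nodes s"
  shows "label v (completion s K L) = label v s"
  using assms(2)
  by (induction v rule: rev_induct) (auto dest: exploredD(5)[OF assms(1)])

lemma Gamma_book_completion:
  assumes "explored s"
  shows "Gamma_book (completion s K L) = Gamma_book s"
  unfolding Gamma_book_def green_completion[OF assms]
  using exploredD(4,8)[OF assms] by (intro image_mset_cong label_completion[OF assms]) auto

lemma is_gamma_completion:
  assumes "explored s"
  shows "is_gamma (completion s K L) v \<longleftrightarrow> is_gamma s v"
proof -
  have *: "label v (completion s K L) = label v s" if "v \<in> green s" for v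
    using that exploredD(8)[OF assms] by (intro label_completion[OF assms]) auto
  show ?thesis
    unfolding is_gamma_def precedes_def green_completion[OF assms] by (simp add: * cong: conj_cong)
qed


section \<open>One step of the operator on a completion\<close>

text \<open>The explored tree when \<open>v\<close> is found to have no further children and turns red.\<close>

definition close_node :: "ltree \<Rightarrow> nat list \<Rightarrow> ltree" where
  "close_node s v = s\<lparr>color := (color s)(v := Red)\<rparr>"

text \<open>The first child of \<open>v\<close> that is not explored.\<close>

definition next_child :: "ltree \<Rightarrow> nat list \<Rightarrow> nat list" where
  "next_child s v = v @ [Suc (num_children s v)]"

text \<open>The explored tree when this child is discovered, with edge label \<open>x\<close>, and turns green.\<close>

definition add_child :: "ltree \<Rightarrow> nat list \<Rightarrow> real \<Rightarrow> ltree" where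
  "add_child s v x =
     s\<lparr>nodes := insert (next_child s v) (nodes s),
       edge_label := (edge_label s)(next_child s v := x),
       color := (color s)(next_child s v := Green)\<rparr>"

lemma close_node_simps [simp]:
  "nodes (close_node s v) = nodes s" "root_label (close_node s v) = root_label s"
  "edge_label (close_node s v) = edge_label s" "color (close_node s v) = (color s)(v := Red)"
  by (simp_all add: close_node_def)

lemma add_child_simps [simp]:
  "nodes (add_child s v x) = insert (next_child s v) (nodes s)"
  "root_label (add_child s v x) = root_label s"
  "edge_label (add_child s v x) = (edge_label s)(next_child s v := x)"
  "color (add_child s v x) = (color s)(next_child s v := Green)"
  by (simp_all add: add_child_def)

lemma next_child_notin: "explored s \<Longrightarrow> next_child s v \<notin> nodes s"
  by (simp add: next_child_def explored_children)

lemma explored_close_node: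
  assumes "explored s" "v \<in> nodes s"
  shows "explored (close_node s v)"
proof -
  have col: "\<forall>w\<in>nodes s. color (close_node s v) w \<in> {Green, Red}"
    using assms by (auto simp: explored_def)
  then have "{w \<in> nodes s. color (close_node s v) w \<in> {Green, Red}} = nodes s" by blast
  moreover have "ulam_harris (nodes s)" "connected_nodes (nodes s)"
    using exploredD(1,7)[OF assms(1)] by (auto simp: trees_def)
  moreover have "color (close_node s v) [] \<in> {Green, Red}"
    using col exploredD(3)[OF assms(1)] by blast
  ultimately show ?thesis
    using exploredD(2)[OF assms(1)] col unfolding explored_def trees_def mem_Collect_eq
    by (simp only: close_node_simps)
qed

lemma explored_add_child:
  assumes s: "explored s" and v: "v \<in> nodes s"
  shows "explored (add_child s v x)"
proof -
  let ?u = "next_child s v"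
  have UH: "ulam_harris (nodes s)" and conn: "connected_nodes (nodes s)"
    using exploredD(1,7)[OF s] by (auto simp: trees_def)
  have "ulam_harris (insert ?u (nodes s))"
    unfolding ulam_harris_def
  proof (intro conjI allI impI)
    show "[] \<in> insert ?u (nodes s)" using exploredD(3)[OF s] by simp
  next
    fix w i assume w: "w @ [i] \<in> insert ?u (nodes s)"
    then consider "w @ [i] \<in> nodes s" | "w = v" "i = Suc (num_children s v)"
      by (auto simp: next_child_def)
    note c = this
    show "w \<in> insert ?u (nodes s)" using c exploredD(5)[OF s] v by cases auto
    show "1 \<le> i" using c explored_children[OF s] by cases auto
    show "w @ [j] \<in> insert ?u (nodes s)" if "1 \<le> j \<and> j \<le> i" for j
      using c that by cases (auto simp: explored_children[OF s] next_child_def)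
  qed
  moreover have col: "\<forall>w\<in>insert ?u (nodes s). color (add_child s v x) w \<in> {Green, Red}"
    using s by (auto simp: explored_def)
  moreover from col have "{w \<in> insert ?u (nodes s). color (add_child s v x) w \<in> {Green, Red}}
      = insert ?u (nodes s)" by blast
  moreover have "connected_nodes (insert ?u (nodes s))"
    unfolding next_child_def by (rule connected_nodes_insert_child[OF conn v])
  moreover have "color (add_child s v x) [] \<in> {Green, Red}"
    using col exploredD(3)[OF s] by blast
  moreover have "finite (insert ?u (nodes s))" using exploredD(2)[OF s] by simp
  ultimately show ?thesis
    unfolding explored_def trees_def mem_Collect_eq by (simp only: add_child_simps)
qed

text \<open>
  If the distinguished node \<open>v\<close> has no further child, then it turns red. The value \<open>K v\<close> plays no
  role in the completion of the resulting explored tree.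
\<close>

lemma Phi_completion_close:
  assumes s: "explored s" and v: "is_gamma s v"
  shows "Phi (completion s (K(v := 0)) L) = completion (close_node s v) K L"
proof -
  let ?t = "completion s (K(v := 0)) L"
  have vs: "v \<in> nodes s" "color s v = Green" using v by (auto simp: is_gamma_def green_def)
  have "Phi ?t = ?t\<lparr>color := (color ?t)(v := Red)\<rparr>"
  proof (rule Phi_Red)
    show "is_gamma ?t v" using v by (simp add: is_gamma_completion[OF s])
    fix j assume "v @ [j] \<in> nodes ?t"
    then have "v @ [j] \<in> nodes s"
      using vs by (simp add: explored_children[OF s] total_offspring_def)
    then show "color ?t (v @ [j]) \<noteq> White" using exploredD(6)[OF s] by simp
  qed
  also have "\<dots> = completion (close_node s v) K L"
  proof -
    have offspring: "total_offspring s (K(v := 0)) = total_offspring (close_node s v) K"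
      using vs by (auto simp: fun_eq_iff total_offspring_def num_children_def)
    show ?thesis using vs by (auto simp: completion_def offspring)
  qed
  finally show ?thesis .
qed

lemma num_children_add_child:
  assumes s: "explored s"
  shows "num_children (add_child s v x) w =
    (if w = v then Suc (num_children s v) else num_children s w)"
proof (cases "w = v")
  case True
  have "{i. v @ [i] \<in> insert (next_child s v) (nodes s)} = {1..Suc (num_children s v)}"
    by (auto simp: next_child_def explored_children[OF s])
  with True show ?thesis by (simp add: num_children_def)
next
  case False
  then show ?thesis by (simp add: num_children_def next_child_def)
qed

text \<open>
  If the distinguished node has at least one further child, then the first of these is discovered
  and the number of its further children drops by one. The label \<open>x\<close> moves from the unknown to the
  explored part.
\<close>

lemma Phi_completion_add:
  assumes s: "explored s" and v: "is_gamma s v"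
  shows "Phi (completion s (K(v := eSuc (K v))) (L(next_child s v := x))) = completion (add_child s v x) K L"
proof -
  let ?u = "next_child s v"
  let ?t = "completion s (K(v := eSuc (K v))) (L(?u := x))"
  have vs: "v \<in> nodes s" "color s v = Green" using v by (auto simp: is_gamma_def green_def)
  have u: "?u \<notin> nodes s" "?u \<noteq> []" "v \<noteq> ?u"
    using next_child_notin[OF s] by (auto simp: next_child_def)
  have "Phi ?t = ?t\<lparr>color := (color ?t)(?u := Green)\<rparr>"
    unfolding next_child_def
  proof (rule Phi_Green, unfold next_child_def[symmetric])
    show "is_gamma ?t v" using v by (simp add: is_gamma_completion[OF s])
    show "color ?t ?u = White" using u by simp
    have "enat (Suc n) \<le> enat n + eSuc k" for n k
      by (cases k) (auto simp: eSuc_enat)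
    then show "?u \<in> nodes ?t"
      using vs nodes_subset_completion[OF s vs(1)]
      by (simp add: next_child_def total_offspring_def)
    fix j assume "v @ [j] \<in> nodes ?t" "color ?t (v @ [j]) = White"
    then have "1 \<le> j" "v @ [j] \<notin> nodes s"
      using exploredD(6)[OF s] by (auto split: if_splits)
    then show "Suc (num_children s v) \<le> j"
      by (simp add: explored_children[OF s])
  qed
  also have "\<dots> = completion (add_child s v x) K L"
  proof -
    have "?u @ [i] \<notin> nodes s" for i using exploredD(5)[OF s, of ?u i] u(1) by blast
    then have "num_children s ?u = 0" by (simp add: num_children_def)
    moreover have "enat n + eSuc k = enat (Suc n) + k" for n k
      by (cases k) (auto simp: eSuc_enat)
    ultimately have offspring: "total_offspring s (K(v := eSuc (K v))) = total_offspring (add_child s v x) K"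
      using vs u by (auto simp: fun_eq_iff total_offspring_def num_children_add_child[OF s] enat_0)
    show ?thesis using u by (auto simp: completion_def offspring)
  qed
  finally show ?thesis .
qed

lemma price_Gamma_book:
  assumes s: "explored s" and v: "is_gamma s v"
  shows "price (Gamma_book s) = label v s"
proof -
  have g: "v \<in> green s" "finite (green s)"
    using v exploredD(4)[OF s] by (auto simp: is_gamma_def)
  have "Max ((\<lambda>v. label v s) ` green s) = label v s"
    using v g by (intro Max_eqI) (auto simp: is_gamma_def precedes_def)
  moreover have "Gamma_book s \<noteq> {#}"
    using g by (auto simp: Gamma_book_def mset_set_empty_iff)
  ultimately show ?thesis using g by (simp add: price_def Gamma_book_def)
qed

lemma Gamma_book_close_node:
  assumes s: "explored s" and v: "is_gamma s v"
  shows "Gamma_book (close_node s v) = Gamma_book s - {#price (Gamma_book s)#}"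
proof -
  have g: "v \<in> green s" "finite (green s)"
    using v exploredD(4)[OF s] by (auto simp: is_gamma_def)
  have l: "label w (close_node s v) = label w s" for w
    by (induction w rule: rev_induct) simp_all
  have "green (close_node s v) = green s - {v}" by (auto simp: green_def)
  then show ?thesis
    using g by (simp add: Gamma_book_def[of "close_node s v"] l price_Gamma_book[OF s v])
      (simp add: Gamma_book_def mset_set_Diff image_mset_Diff)
qed

lemma Gamma_book_add_child:
  assumes s: "explored s" and v: "is_gamma s v"
  shows "Gamma_book (add_child s v x) = Gamma_book s + {#price (Gamma_book s) + x#}"
proof -
  let ?s = "add_child s v x"
  have g: "v \<in> green s" "v \<in> nodes s" "finite (green s)"
    using v exploredD(4,8)[OF s] by (auto simp: is_gamma_def)
  have l: "label w ?s = label w s" if "w \<in> nodes s" for w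
    using that
  proof (induction w rule: rev_induct)
    case (snoc i w)
    then show ?case using next_child_notin[OF s, of v] exploredD(5)[OF s snoc.prems] by auto
  qed simp
  have u: "label (next_child s v) ?s = label v s + x"
    using l[OF g(2)] by (simp add: next_child_def)
  have "green ?s = insert (next_child s v) (green s)" by (auto simp: green_def)
  moreover have "next_child s v \<notin> green s"
    using next_child_notin[OF s] exploredD(8)[OF s] by auto
  moreover have "image_mset (\<lambda>w. label w ?s) (mset_set (green s)) = Gamma_book s"
    unfolding Gamma_book_def using g exploredD(8)[OF s] by (intro image_mset_cong l) auto
  ultimately show ?thesis
    using g by (simp add: Gamma_book_def[of ?s] u price_Gamma_book[OF s v])
qed


section \<open>Integration over the randomness that is still unknown\<close>

lemma measurable_completion:
  assumes s: "explored s" and \<mu>: "sets \<mu> = sets borel"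
  shows "(\<lambda>(K, L). completion s K L) \<in>
    (PiM UNIV (\<lambda>_. measure_pmf (offspring_pmf p)) \<Otimes>\<^sub>M PiM UNIV (\<lambda>_. \<mu>)) \<rightarrow>\<^sub>M tree_space"
    (is "_ \<in> ?P \<rightarrow>\<^sub>M _")
proof -
  have K: "(\<lambda>x. fst x v) \<in> ?P \<rightarrow>\<^sub>M count_space UNIV" for v
  proof -
    have "(\<lambda>x. fst x v) \<in> ?P \<rightarrow>\<^sub>M measure_pmf (offspring_pmf p)" by measurable
    then show ?thesis by (simp cong: measurable_cong_sets)
  qed
  have L: "(\<lambda>x. snd x v) \<in> ?P \<rightarrow>\<^sub>M borel" for v
  proof -
    have "(\<lambda>x. snd x v) \<in> ?P \<rightarrow>\<^sub>M \<mu>" by measurable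
    then show ?thesis using measurable_cong_sets[OF refl \<mu>] by blast
  qed
  have offspring: "(\<lambda>x. total_offspring s (fst x) v) \<in> ?P \<rightarrow>\<^sub>M count_space UNIV" for v
    using measurable_compose[OF K, of
        "\<lambda>k. if v \<in> nodes s then enat (num_children s v) + (if color s v = Green then k else 0) else k"
        "count_space UNIV" v]
    unfolding total_offspring_def by simp
  have nodes: "Measurable.pred ?P (\<lambda>x. v \<in> gw_nodes (total_offspring s (fst x)))" for v
  proof (induction v rule: rev_induct)
    case (snoc i v)
    have "Measurable.pred ?P (\<lambda>x. enat i \<le> total_offspring s (fst x) v)"
      using measurable_compose[OF offspring, of "\<lambda>k. enat i \<le> k" "count_space UNIV" v] by simp
    with snoc show ?case by simp
  qed simp
  show ?thesis
    unfolding split_beta'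
  proof (rule measurable_tree_spaceI)
    show "completion s (fst x) (snd x) \<in> trees" for x by (rule completion_in_trees[OF s])
    show "Measurable.pred ?P (\<lambda>x. v \<in> nodes (completion s (fst x) (snd x)))" for v
      using nodes by simp
    show "(\<lambda>x. root_label (completion s (fst x) (snd x))) \<in> borel_measurable ?P" by simp
    show "Measurable.pred ?P (\<lambda>x. v \<in> nodes (completion s (fst x) (snd x))
        \<and> edge_label (completion s (fst x) (snd x)) v \<in> A)" if "A \<in> sets borel" for v A
    proof -
      have "Measurable.pred ?P (\<lambda>x. snd x v \<in> A)" using L that by measurable
      then have "Measurable.pred ?P
          (\<lambda>x. (if v \<in> nodes s \<and> v \<noteq> [] then edge_label s v else snd x v) \<in> A)"
        by (cases "v \<in> nodes s \<and> v \<noteq> []") simp_all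
      with nodes show ?thesis unfolding completion_simps by (intro pred_intros_logic)
    qed
    show "Measurable.pred ?P (\<lambda>x. v \<in> nodes (completion s (fst x) (snd x))
        \<and> color (completion s (fst x) (snd x)) v = c)" for v c
      unfolding completion_simps by (intro pred_intros_logic nodes) (rule measurable_const, simp)
  qed
qed

text \<open>One coordinate of a family of independent random variables can be integrated separately.\<close>

lemma nn_integral_PiM_fun_upd:
  fixes M :: "'i \<Rightarrow> 'a measure"
  assumes M: "\<And>i. prob_space (M i)" and f: "f \<in> borel_measurable (PiM UNIV M)"
  shows "(\<integral>\<^sup>+ X. f X \<partial>PiM UNIV M) = (\<integral>\<^sup>+ x. \<integral>\<^sup>+ X. f (X(i := x)) \<partial>PiM UNIV M \<partial>M i)"
proof -
  interpret P: prob_space "PiM UNIV M" by (intro prob_space_PiM M)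
  have upd: "(\<lambda>(x, X). X(i := x)) \<in> M i \<Otimes>\<^sub>M PiM UNIV M \<rightarrow>\<^sub>M PiM UNIV M"
    unfolding split_beta' by (rule measurable_fun_upd[where J = UNIV]) auto
  have "distr (M i \<Otimes>\<^sub>M PiM UNIV M) (PiM UNIV M) (\<lambda>(x, X). X(i := x)) = PiM UNIV M"
    using distr_pair_PiM_eq_PiM[of UNIV M i] M by simp
  then have "(\<integral>\<^sup>+ X. f X \<partial>PiM UNIV M)
      = (\<integral>\<^sup>+ X. f X \<partial>distr (M i \<Otimes>\<^sub>M PiM UNIV M) (PiM UNIV M) (\<lambda>(x, X). X(i := x)))"
    by simp
  also have "\<dots> = (\<integral>\<^sup>+ z. f ((\<lambda>(x, X). X(i := x)) z) \<partial>(M i \<Otimes>\<^sub>M PiM UNIV M))"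
    by (rule nn_integral_distr[OF upd]) (simp add: f)
  also have "\<dots> = (\<integral>\<^sup>+ x. \<integral>\<^sup>+ X. f (X(i := x)) \<partial>PiM UNIV M \<partial>M i)"
    using measurable_compose[OF upd f] by (subst P.nn_integral_fst[symmetric]) simp_all
  finally show ?thesis .
qed

text \<open>
  The memoryless property: an offspring number is zero with probability \<open>1 - p\<close>, and otherwise it
  is one plus an offspring number. For \<open>p = 1\<close> this is the equality of infinity and its successor.
\<close>

lemma nn_integral_offspring_pmf:
  assumes "0 \<le> p" "p \<le> 1"
  shows "(\<integral>\<^sup>+ k. h k \<partial>offspring_pmf p)
    = ennreal (1 - p) * h 0 + ennreal p * (\<integral>\<^sup>+ k. h (eSuc k) \<partial>offspring_pmf p)"
proof (cases "p = 1")
  case True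
  then show ?thesis by (simp add: offspring_pmf_def nn_integral_return_pmf)
next
  case False
  with assms have p: "1 - p \<in> {0<..1}" by auto
  have "(\<integral>\<^sup>+ k. h k \<partial>offspring_pmf p) = (\<integral>\<^sup>+ n. h (enat n) \<partial>geometric_pmf (1 - p))"
    using False by (simp add: offspring_pmf_def)
  also have "\<dots> = ennreal (1 - p) * h (enat 0)
      + ennreal p * (\<integral>\<^sup>+ n. h (enat (Suc n)) \<partial>geometric_pmf (1 - p))"
    using p assms by (subst geometric_bind_pmf_unfold) (simp_all add: mult.commute)
  finally show ?thesis
    using False by (simp add: offspring_pmf_def enat_0 eSuc_enat)
qed

text \<open>The memoryless property for one member of a family of independent offspring numbers.\<close>

lemma nn_integral_PiM_offspring:
  fixes v :: 'i
  assumes p: "0 \<le> p" "p \<le> 1"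
    and f: "f \<in> borel_measurable (PiM UNIV (\<lambda>_. measure_pmf (offspring_pmf p)))" (is "f \<in> borel_measurable ?K")
  shows "(\<integral>\<^sup>+ K. f K \<partial>?K) =
    ennreal (1 - p) * (\<integral>\<^sup>+ K. f (K(v := 0)) \<partial>?K)
      + ennreal p * (\<integral>\<^sup>+ K. f (K(v := eSuc (K v))) \<partial>?K)"
proof -
  have pr: "prob_space (measure_pmf (offspring_pmf p))" by (rule measure_pmf.prob_space_axioms)
  have "(\<lambda>K. K(v := eSuc (K v))) \<in> ?K \<rightarrow>\<^sub>M ?K"
  proof (rule measurable_fun_upd[where J = UNIV])
    have "(\<lambda>K. K v) \<in> ?K \<rightarrow>\<^sub>M measure_pmf (offspring_pmf p)" by measurable
    then show "(\<lambda>K. eSuc (K v)) \<in> ?K \<rightarrow>\<^sub>M measure_pmf (offspring_pmf p)"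
      by (rule measurable_compose) simp
  qed auto
  then have f': "(\<lambda>K. f (K(v := eSuc (K v)))) \<in> borel_measurable ?K"
    by (rule measurable_compose[OF _ f])
  have "(\<integral>\<^sup>+ K. f K \<partial>?K) = (\<integral>\<^sup>+ k. \<integral>\<^sup>+ K. f (K(v := k)) \<partial>?K \<partial>offspring_pmf p)"
    by (rule nn_integral_PiM_fun_upd[OF pr f])
  also have "\<dots> = ennreal (1 - p) * (\<integral>\<^sup>+ K. f (K(v := 0)) \<partial>?K)
      + ennreal p * (\<integral>\<^sup>+ k. \<integral>\<^sup>+ K. f (K(v := eSuc k)) \<partial>?K \<partial>offspring_pmf p)"
    by (rule nn_integral_offspring_pmf[OF p])
  also have "(\<integral>\<^sup>+ k. \<integral>\<^sup>+ K. f (K(v := eSuc k)) \<partial>?K \<partial>offspring_pmf p)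
      = (\<integral>\<^sup>+ K. f (K(v := eSuc (K v))) \<partial>?K)"
    by (subst nn_integral_PiM_fun_upd[OF pr f', of v]) simp
  finally show ?thesis .
qed

text \<open>The indicator of the event that the killed path of a tree is in \<open>A i\<close> for all \<open>i \<le> n\<close>.\<close>

definition tree_cylinder :: "nat \<Rightarrow> (nat \<Rightarrow> book option set) \<Rightarrow> ltree \<Rightarrow> ennreal" where
  "tree_cylinder n A t = (\<Prod>i\<le>n. indicator (A i) (killed (\<lambda>n. Gamma_book ((Phi ^^ n) t)) i))"

lemma measurable_tree_cylinder:
  assumes "\<And>i. A i \<in> sets (option_space book_space)"
  shows "tree_cylinder n A \<in> borel_measurable tree_space"
  unfolding tree_cylinder_def[abs_def]
  by (intro borel_measurable_prod_ennreal
      measurable_compose[OF measurable_tree_path borel_measurable_indicator] assms)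

lemma tree_cylinder_Suc:
  "tree_cylinder (Suc n) A t = indicator (A 0) (Some (Gamma_book t)) *
    (if Gamma_book t = {#} then \<Prod>i\<le>n. indicator (A (Suc i)) None
     else tree_cylinder n (\<lambda>i. A (Suc i)) (Phi t))"
  by (simp add: tree_cylinder_def prod.atMost_Suc_shift killed_Suc funpow_swap1
      del: prod.atMost_Suc)

text \<open>
  For a random completion of an explored tree, the path of books has the law of the killed chain
  started at the book of the explored tree. A step of \<open>Phi\<close> amounts to closing the distinguished
  node with probability \<open>1 - p\<close> and to adding a child, with a label distributed like \<open>X\<close>, with
  probability \<open>p\<close>; in both cases the result is a random completion of the new explored tree, with
  the same law of \<open>K\<close> and \<open>L\<close>.
\<close>

lemma nn_integral_tree_cylinder:
  assumes p: "0 \<le> p" "p \<le> 1" and N: "prob_space N" and X: "X \<in> borel_measurable N"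
    and s: "explored s" and A: "\<And>i. A i \<in> sets (option_space book_space)"
  shows "(\<integral>\<^sup>+ (K, L). tree_cylinder n A (completion s K L)
        \<partial>(PiM UNIV (\<lambda>_. measure_pmf (offspring_pmf p)) \<Otimes>\<^sub>M PiM UNIV (\<lambda>_. distr N borel X)))
      = cylinder_prob p N X n A (Some (Gamma_book s))"
  using s A
proof (induction n arbitrary: s A)
  let ?\<mu> = "distr N borel X"
  let ?K = "PiM (UNIV :: nat list set) (\<lambda>_. measure_pmf (offspring_pmf p))"
  let ?L = "PiM (UNIV :: nat list set) (\<lambda>_. ?\<mu>)"
  have \<mu>: "prob_space ?\<mu>" by (rule prob_space.prob_space_distr[OF N X])
  interpret K: prob_space ?K by (intro prob_space_PiM measure_pmf.prob_space_axioms)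
  interpret L: prob_space ?L by (intro prob_space_PiM \<mu>)
  interpret KL: pair_prob_space ?K ?L ..
  {
    case 0
    show ?case
      by (simp add: tree_cylinder_def Gamma_book_completion[OF 0(1)] KL.emeasure_space_1 split_beta')
  next
    case (Suc n)
    note s = Suc.prems(1) and A = Suc.prems(2)
    let ?A = "\<lambda>i. A (Suc i)"
    let ?I = "indicator (A 0) (Some (Gamma_book s)) :: ennreal"
    show ?case
    proof (cases "green s = {}")
      case True
      then have e: "Gamma_book s = {#}" by (simp add: Gamma_book_eq_empty_iff[OF exploredD(1)[OF s]])
      show ?thesis
        by (simp add: tree_cylinder_Suc Gamma_book_completion[OF s] e killed_step_def
            cylinder_prob_None KL.emeasure_space_1 split_beta')
    next
      case False
      then have ne: "Gamma_book s \<noteq> {#}" by (simp add: Gamma_book_eq_empty_iff[OF exploredD(1)[OF s]])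
      define v where "v = gamma_node s"
      have v: "is_gamma s v" unfolding v_def by (rule is_gamma_gamma_node[OF exploredD(4)[OF s] False])
      then have vs: "v \<in> nodes s" by (auto simp: is_gamma_def green_def)
      define H where "H K L = tree_cylinder n ?A (Phi (completion s K L))" for K L
      define R where "R L = (\<integral>\<^sup>+ K. H (K(v := eSuc (K v))) L \<partial>?K)" for L
      have cyl: "(\<lambda>(K, L). tree_cylinder n ?A (completion s' K L)) \<in> borel_measurable (?K \<Otimes>\<^sub>M ?L)"
        if "explored s'" for s'
        using measurable_compose[OF measurable_completion[OF that, of ?\<mu> p]
            measurable_tree_cylinder[of ?A n]] A by (simp add: split_beta')
      have H: "(\<lambda>(K, L). H K L) \<in> borel_measurable (?K \<Otimes>\<^sub>M ?L)"
        using measurable_compose[OF measurable_compose[OF measurable_completion[OF s, of ?\<mu> p] measurable_Phi]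
            measurable_tree_cylinder[of ?A n]] A by (simp add: split_beta' H_def)
      have "(\<lambda>z. ((fst z)(v := eSuc (fst z v)), snd z)) \<in> ?K \<Otimes>\<^sub>M ?L \<rightarrow>\<^sub>M ?K \<Otimes>\<^sub>M ?L"
      proof (intro measurable_Pair measurable_snd measurable_fun_upd[where J = UNIV])
        have "(\<lambda>z. fst z v) \<in> ?K \<Otimes>\<^sub>M ?L \<rightarrow>\<^sub>M measure_pmf (offspring_pmf p)" by measurable
        then show "(\<lambda>z. eSuc (fst z v)) \<in> ?K \<Otimes>\<^sub>M ?L \<rightarrow>\<^sub>M measure_pmf (offspring_pmf p)"
          by (rule measurable_compose) simp
      qed auto
      from measurable_compose[OF this H]
      have R: "R \<in> borel_measurable ?L"
        unfolding R_def[abs_def]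
        by (intro K.borel_measurable_nn_integral)
           (simp add: split_beta' measurable_pair_swap_iff[of _ ?L])
      \<comment> \<open>the distinguished node has no further child\<close>
      have close: "(\<integral>\<^sup>+ L. \<integral>\<^sup>+ K. H (K(v := 0)) L \<partial>?K \<partial>?L)
          = cylinder_prob p N X n ?A (Some (Gamma_book s - {#price (Gamma_book s)#}))"
      proof -
        have s': "explored (close_node s v)" by (rule explored_close_node[OF s vs])
        show ?thesis
          unfolding H_def Phi_completion_close[OF s v]
          using Suc.IH[OF s' A] KL.nn_integral_snd[OF cyl[OF s']]
          by (simp add: Gamma_book_close_node[OF s v] split_beta')
      qed
      \<comment> \<open>it has one: the label of the edge to that child is integrated last, because the explored
        tree depends on it\<close>
      have add: "(\<integral>\<^sup>+ L. R L \<partial>?L) = (\<integral>\<^sup>+ \<omega>. cylinder_prob p N X n ?A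
          (Some (Gamma_book s + {#price (Gamma_book s) + X \<omega>#})) \<partial>N)"
      proof -
        have s': "explored (add_child s v x)" for x by (rule explored_add_child[OF s vs])
        have "(\<integral>\<^sup>+ L. R L \<partial>?L) = (\<integral>\<^sup>+ x. \<integral>\<^sup>+ L. R (L(next_child s v := x)) \<partial>?L \<partial>?\<mu>)"
          by (rule nn_integral_PiM_fun_upd[OF \<mu> R])
        also have "(\<lambda>x. \<integral>\<^sup>+ L. R (L(next_child s v := x)) \<partial>?L)
            = (\<lambda>x. cylinder_prob p N X n ?A (Some (Gamma_book s + {#price (Gamma_book s) + x#})))"
        proof
          fix x
          show "(\<integral>\<^sup>+ L. R (L(next_child s v := x)) \<partial>?L)
              = cylinder_prob p N X n ?A (Some (Gamma_book s + {#price (Gamma_book s) + x#}))"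
            unfolding R_def H_def Phi_completion_add[OF s v]
            using Suc.IH[OF s' A] KL.nn_integral_snd[OF cyl[OF s']]
            by (simp add: Gamma_book_add_child[OF s v] split_beta')
        qed
        also have "(\<integral>\<^sup>+ x. cylinder_prob p N X n ?A
              (Some (Gamma_book s + {#price (Gamma_book s) + x#})) \<partial>?\<mu>)
            = (\<integral>\<^sup>+ \<omega>. cylinder_prob p N X n ?A
              (Some (Gamma_book s + {#price (Gamma_book s) + X \<omega>#})) \<partial>N)"
        proof (rule nn_integral_distr[OF X])
          have "(\<lambda>x. add_mset (price (Gamma_book s) + x) (Gamma_book s)) \<in> borel \<rightarrow>\<^sub>M book_space"
            by (intro measurable_add_book) simp_all
          from measurable_compose[OF measurable_compose[OF this measurable_Some]
              measurable_cylinder_prob[OF N X A]]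
          show "(\<lambda>x. cylinder_prob p N X n ?A (Some (Gamma_book s + {#price (Gamma_book s) + x#})))
              \<in> borel_measurable (distr N borel X)" by simp
        qed
        finally show ?thesis .
      qed
      have "(\<integral>\<^sup>+ (K, L). tree_cylinder (Suc n) A (completion s K L) \<partial>(?K \<Otimes>\<^sub>M ?L))
          = (\<integral>\<^sup>+ z. ?I * (case z of (K, L) \<Rightarrow> H K L) \<partial>(?K \<Otimes>\<^sub>M ?L))"
        by (simp add: tree_cylinder_Suc Gamma_book_completion[OF s] ne H_def split_beta')
      also have "\<dots> = ?I * (\<integral>\<^sup>+ L. \<integral>\<^sup>+ K. H K L \<partial>?K \<partial>?L)"
        using H by (simp add: nn_integral_cmult KL.nn_integral_snd[OF H, symmetric])
      also have "(\<integral>\<^sup>+ L. \<integral>\<^sup>+ K. H K L \<partial>?K \<partial>?L)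
          = (\<integral>\<^sup>+ L. ennreal (1 - p) * (\<integral>\<^sup>+ K. H (K(v := 0)) L \<partial>?K) + ennreal p * R L \<partial>?L)"
      proof (rule nn_integral_cong)
        fix L assume "L \<in> space ?L"
        then have "(\<lambda>K. H K L) \<in> borel_measurable ?K"
          using measurable_compose[OF measurable_Pair2' H] by simp
        from nn_integral_PiM_offspring[OF p this]
        show "(\<integral>\<^sup>+ K. H K L \<partial>?K)
            = ennreal (1 - p) * (\<integral>\<^sup>+ K. H (K(v := 0)) L \<partial>?K) + ennreal p * R L"
          unfolding R_def .
      qed
      also have "\<dots> = ennreal (1 - p) * (\<integral>\<^sup>+ L. \<integral>\<^sup>+ K. H (K(v := 0)) L \<partial>?K \<partial>?L)
          + ennreal p * (\<integral>\<^sup>+ L. R L \<partial>?L)"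
      proof -
        have "(\<lambda>L. \<integral>\<^sup>+ K. H (K(v := 0)) L \<partial>?K) \<in> borel_measurable ?L"
          unfolding H_def Phi_completion_close[OF s v]
          using cyl[OF explored_close_node[OF s vs]]
          by (intro K.borel_measurable_nn_integral)
             (simp add: split_beta' measurable_pair_swap_iff[of _ ?L])
        with R show ?thesis by (simp add: nn_integral_add nn_integral_cmult)
      qed
      finally show ?thesis
        unfolding close add
        using ne by (simp add: killed_step_def lob_step_def add.commute)
    qed
  }
qed

text \<open>The initial tree is the completion of a single green node.\<close>

lemma completion_root:
  "completion \<lparr>nodes = {[]}, root_label = 0, edge_label = l, color = (\<lambda>_. Green)\<rparr> K L = initial_tree K L"
  by (auto simp: completion_def initial_tree_def total_offspring_def[abs_def] num_children_def
      enat_0 fun_eq_iff intro!: arg_cong[where f = gw_nodes])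

lemma explored_root:
  "explored \<lparr>nodes = {[]}, root_label = 0, edge_label = l, color = (\<lambda>_. Green)\<rparr>"
  by (simp add: explored_def trees_def ulam_harris_def connected_nodes_def)

lemma Gamma_book_root:
  "Gamma_book \<lparr>nodes = {[]}, root_label = 0, edge_label = l, color = (\<lambda>_. Green)\<rparr> = {#0#}"
  by (simp add: Gamma_book_def green_def)


section \<open>Equality of the laws of the two paths\<close>

lemma distr_PiM_nat_eqI:
  fixes S :: "'s measure"
  assumes "prob_space M" and Y: "Y \<in> M \<rightarrow>\<^sub>M PiM UNIV (\<lambda>_::nat. S)" and Z: "Z \<in> M' \<rightarrow>\<^sub>M PiM UNIV (\<lambda>_. S)"
    and eq: "\<And>n A. (\<And>i. A i \<in> sets S) \<Longrightarrow>
      (\<integral>\<^sup>+ \<omega>. (\<Prod>i\<le>n. indicator (A i) (Y \<omega> i)) \<partial>M) = (\<integral>\<^sup>+ \<omega>. (\<Prod>i\<le>n. indicator (A i) (Z \<omega> i)) \<partial>M')"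
  shows "distr M (PiM UNIV (\<lambda>_. S)) Y = distr M' (PiM UNIV (\<lambda>_. S)) Z"
proof (rule measure_eqI_PiM_infinite)
  show "finite_measure (distr M (PiM UNIV (\<lambda>_. S)) Y)"
    using prob_space.prob_space_distr[OF assms(1) Y] by (simp add: prob_space_def)
  fix A :: "nat \<Rightarrow> 's set" and J assume J: "finite J" "J \<subseteq> UNIV" and A: "\<And>i. i \<in> J \<Longrightarrow> A i \<in> sets S"
  let ?E = "prod_emb UNIV (\<lambda>_. S) J (Pi\<^sub>E J A)"
  define A' where "A' i = (if i \<in> J then A i else space S)" for i
  obtain n where n: "J \<subseteq> {..n}" using finite_nat_iff_bounded_le J(1) by auto
  have E: "?E \<in> sets (PiM UNIV (\<lambda>_. S))" using J A by (intro sets_PiM_I) auto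
  have ind: "indicator ?E y = (\<Prod>i\<le>n. indicator (A' i) (y i) :: ennreal)"
    if "y \<in> space (PiM UNIV (\<lambda>_. S))" for y
  proof -
    have "y \<in> ?E \<longleftrightarrow> (\<forall>i\<le>n. y i \<in> A' i)"
      using that n by (auto simp: prod_emb_def A'_def space_PiM PiE_iff split: if_splits)
    then show ?thesis by (auto simp: indicator_def prod_zero_iff intro!: prod.neutral[symmetric])
  qed
  have *: "emeasure (distr Q (PiM UNIV (\<lambda>_. S)) W) ?E = (\<integral>\<^sup>+ \<omega>. (\<Prod>i\<le>n. indicator (A' i) (W \<omega> i)) \<partial>Q)"
    if W: "W \<in> Q \<rightarrow>\<^sub>M PiM UNIV (\<lambda>_. S)" for W and Q :: "'q measure"
  proof -
    have "emeasure (distr Q (PiM UNIV (\<lambda>_. S)) W) ?E = (\<integral>\<^sup>+ y. indicator ?E y \<partial>distr Q (PiM UNIV (\<lambda>_. S)) W)"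
      using E by simp
    also have "\<dots> = (\<integral>\<^sup>+ \<omega>. indicator ?E (W \<omega>) \<partial>Q)"
      using E by (intro nn_integral_distr[OF W]) simp
    also have "\<dots> = (\<integral>\<^sup>+ \<omega>. (\<Prod>i\<le>n. indicator (A' i) (W \<omega> i)) \<partial>Q)"
      by (intro nn_integral_cong ind measurable_space[OF W])
    finally show ?thesis .
  qed
  have "A' i \<in> sets S" for i using A by (simp add: A'_def)
  then show "emeasure (distr M (PiM UNIV (\<lambda>_. S)) Y) ?E = emeasure (distr M' (PiM UNIV (\<lambda>_. S)) Z) ?E"
    unfolding *[OF Y] *[OF Z] by (rule eq)
qed simp_all

lemma space_option_book_space: "space (option_space book_space) = UNIV"
  using notin_range_Some by (auto simp: space_option_space)

theorem theorem2:
  fixes p :: real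
    and N :: "'b measure" and X :: "'b \<Rightarrow> real"
    and M :: "'a measure" and T :: "'a \<Rightarrow> ltree"
    and M' :: "'c measure" and B :: "nat \<Rightarrow> 'c \<Rightarrow> book"
  assumes "0 \<le> p" and "p \<le> 1"
    and "prob_space N" and "X \<in> borel_measurable N"
    and "prob_space M" and "T \<in> M \<rightarrow>\<^sub>M tree_space"
    and "distr M tree_space T = random_tree_law p (distr N borel X)"
    and "lob_chain p N X M' B" and "AE \<omega> in M'. B 0 \<omega> = {#0#}"
  shows "eq_in_distr path_space
           M (\<lambda>\<omega>. up_to (kappa (T \<omega>)) (\<lambda>n. Gamma_book ((Phi ^^ n) (T \<omega>))))
           M' (\<lambda>\<omega>. up_to (tau (\<lambda>n. B n \<omega>)) (\<lambda>n. B n \<omega>))"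
proof -
  note p = assms(1,2) and N = assms(3,4) and T = assms(6)
  let ?Y = "\<lambda>\<omega>. up_to (kappa (T \<omega>)) (\<lambda>n. Gamma_book ((Phi ^^ n) (T \<omega>)))"
  let ?Z = "\<lambda>\<omega>. up_to (tau (\<lambda>n. B n \<omega>)) (\<lambda>n. B n \<omega>)"
  let ?P = "PiM (UNIV :: nat list set) (\<lambda>_. measure_pmf (offspring_pmf p))
    \<Otimes>\<^sub>M PiM (UNIV :: nat list set) (\<lambda>_. distr N borel X)"
  have Y_eq: "?Y \<omega> = killed (\<lambda>n. Gamma_book ((Phi ^^ n) (T \<omega>)))" if "\<omega> \<in> space M" for \<omega>
    using measurable_space[OF T that] by (simp add: up_to_kappa)
  have Z_eq: "?Z = (\<lambda>\<omega>. killed (\<lambda>n. B n \<omega>))" by (simp add: killed_def)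
  have Y: "?Y \<in> M \<rightarrow>\<^sub>M path_space"
  proof -
    have "(\<lambda>\<omega>. killed (\<lambda>n. Gamma_book ((Phi ^^ n) (T \<omega>)))) \<in> M \<rightarrow>\<^sub>M path_space"
      unfolding path_space_def
      by (rule measurable_PiM_single')
         (auto intro: measurable_compose[OF T measurable_tree_path] simp: space_option_book_space PiE_iff)
    then show ?thesis by (subst measurable_cong[OF Y_eq])
  qed
  have B: "B n \<in> M' \<rightarrow>\<^sub>M book_space" for n using assms(8) by (simp add: lob_chain_def)
  have Z: "?Z \<in> M' \<rightarrow>\<^sub>M path_space"
    unfolding path_space_def Z_eq
    by (rule measurable_PiM_single') (auto intro!: measurable_killed B simp: space_option_book_space PiE_iff)
  have "(\<integral>\<^sup>+ \<omega>. (\<Prod>i\<le>n. indicator (A i) (?Y \<omega> i)) \<partial>M)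
      = (\<integral>\<^sup>+ \<omega>. (\<Prod>i\<le>n. indicator (A i) (?Z \<omega> i)) \<partial>M')"
    if A: "\<And>i. A i \<in> sets (option_space book_space)" for n A
  proof -
    note cyl = measurable_tree_cylinder[of A n, OF A]
    have "(\<integral>\<^sup>+ \<omega>. (\<Prod>i\<le>n. indicator (A i) (?Y \<omega> i)) \<partial>M) = (\<integral>\<^sup>+ \<omega>. tree_cylinder n A (T \<omega>) \<partial>M)"
      by (intro nn_integral_cong) (simp add: tree_cylinder_def Y_eq)
    also have "\<dots> = (\<integral>\<^sup>+ t. tree_cylinder n A t \<partial>random_tree_law p (distr N borel X))"
      unfolding assms(7)[symmetric] by (rule nn_integral_distr[OF T, symmetric]) (simp add: cyl)
    also have "\<dots> = (\<integral>\<^sup>+ (K, L). tree_cylinder n A (initial_tree K L) \<partial>?P)"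
      unfolding random_tree_law_def
      by (subst nn_integral_distr[OF measurable_initial_tree]) (simp_all add: cyl split_beta')
    also have "\<dots> = cylinder_prob p N X n A (Some {#0#})"
      using nn_integral_tree_cylinder[OF p N explored_root A]
      unfolding completion_root Gamma_book_root .
    also have "\<dots> = (\<integral>\<^sup>+ \<omega>. (\<Prod>i\<le>n. indicator (A i) (?Z \<omega> i)) \<partial>M')"
      using lob_chain_cylinder[OF p N assms(8,9) A, where n = n] by (simp add: killed_def)
    finally show ?thesis .
  qed
  then have "distr M path_space ?Y = distr M' path_space ?Z"
    using distr_PiM_nat_eqI[OF assms(5)] Y Z unfolding path_space_def by blast
  with Y Z show ?thesis by (simp add: eq_in_distr_def)
qed

end
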